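(* Let $H$ be an infinite dimensional complex separable Hilbert space, let $S\in\mathcal{L}(H)$ be a compact positive operator ($\langle Sx,x\rangle>0$ for $x\ne0$), let $A\in\mathcal{L}(H)$ be self-adjoint, and let $K=SA$ (a compact symmetrizable operator). Let $[a,b]$ be a finite closed interval which contains the spectrum of $K$. Then there exists a norm continuous, unital algebra homomorphism $$\Phi:C^{(1)}[a,b]\longrightarrow\mathcal{L}(H)$$ given by the formula $$\Phi(\phi)=\phi(0)I+\sum_n[\phi(\lambda_n)-\phi(0)]\,\langle\cdot,g_n\rangle f_n .$$ If $p$ is a polynomial function, then $\Phi(p)=p(K^* )$.
   Context: $\mathcal{L}(H)$ is the algebra of bounded linear operators on $H$. An operator $K\in\mathcal{L}(H)$ is symmetrizable by a positive operator $S$ if $SK^*=KS$. For $K$ compact and symmetrizable, the non-zero eigenvalues of $K$ and $K^*$ coincide, are real, of finite multiplicity, without generalized eigenvectors. $(\lambda_n)_{n\ge0}$ is the (finite or infinite) list of non-zero eigenvalues of $K$ repeated according to multiplicity, with eigenvectors $K^*f_n=\lambda_nf_n$, $g_n=Sf_n$, $Kg_n=\lambda_ng_n$, normalized by $\langle\sqrt S f_k,\sqrt S f_\ell\rangle=\langle f_k,g_\ell\rangle=\delta_{k\ell}$. $C^{(1)}[a,b]$ is the algebra of complex-valued continuously differentiable functions on $[a,b]$ with its usual norm. *)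

theory Defs
  imports "HOL-Analysis.Analysis"
begin

section \<open>Complex Hilbert spaces\<close>

text \<open>
  The library only has real inner product spaces. A complex Hilbert space is a complete real
  inner product space with a compatible complex scalar multiplication and a complex inner product
  whose real part is the given real one; in particular the norm is \<open>sqrt (cinner x x)\<close>.
  The complex inner product is linear in its \<^emph>\<open>first\<close> argument.
\<close>

class complex_hilbert = real_inner + complete_space +
  fixes scaleC :: "complex \<Rightarrow> 'a \<Rightarrow> 'a" (infixr \<open>*\<^sub>C\<close> 75)
    and cinner :: "'a \<Rightarrow> 'a \<Rightarrow> complex"
  assumes scaleC_add_right: "c *\<^sub>C (x + y) = c *\<^sub>C x + c *\<^sub>C y"
    and scaleC_add_left: "(c + d) *\<^sub>C x = c *\<^sub>C x + d *\<^sub>C x"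
    and scaleC_scaleC: "c *\<^sub>C d *\<^sub>C x = (c * d) *\<^sub>C x"
    and scaleC_of_real: "complex_of_real r *\<^sub>C x = r *\<^sub>R x"
    and cinner_commute: "cinner x y = cnj (cinner y x)"
    and cinner_add_left: "cinner (x + y) z = cinner x z + cinner y z"
    and cinner_scaleC_left: "cinner (c *\<^sub>C x) y = c * cinner x y"
    and inner_eq_Re_cinner: "inner x y = Re (cinner x y)"

subclass (in complex_hilbert) banach ..

interpretation complex_vector: vector_space "scaleC :: complex \<Rightarrow> 'a \<Rightarrow> 'a::complex_hilbert"
proof
  fix x :: 'a
  show "1 *\<^sub>C x = x"
    using scaleC_of_real[of 1 x] by simp
qed (simp_all add: scaleC_add_right scaleC_add_left scaleC_scaleC)

lemma norm_scaleC: "norm (c *\<^sub>C x) = cmod c * norm (x::'a::complex_hilbert)"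
proof -
  have 1: "cinner x (c *\<^sub>C x) = cnj c * cinner x x"
    by (metis cinner_commute cinner_scaleC_left complex_cnj_mult)
  have "inner (c *\<^sub>C x) (c *\<^sub>C x) = (cmod c)\<^sup>2 * inner x x"
    unfolding cmod_power2
    by (simp add: inner_eq_Re_cinner cinner_scaleC_left 1 power2_eq_square algebra_simps)
  then show ?thesis
    by (simp add: norm_eq_sqrt_inner real_sqrt_mult)
qed

lemma bounded_linear_scaleC: "bounded_linear (\<lambda>x::'a::complex_hilbert. c *\<^sub>C x)"
proof (rule bounded_linear_intro[where K = "cmod c"])
  show "c *\<^sub>C r *\<^sub>R x = r *\<^sub>R c *\<^sub>C x" for r and x :: 'a
    by (simp add: scaleC_of_real[symmetric] scaleC_scaleC mult.commute)
qed (simp_all add: scaleC_add_right norm_scaleC mult.commute)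

lemma norm_cinner_le: "cmod (cinner x y) \<le> norm x * norm (y::'a::complex_hilbert)"
proof (cases "cinner x y = 0")
  case False
  define u where "u = cnj (sgn (cinner x y))"
  have u: "cmod u = 1"
    using False by (simp add: u_def norm_sgn)
  have "cinner (u *\<^sub>C x) y = complex_of_real (cmod (cinner x y))"
    using False by (simp add: cinner_scaleC_left u_def sgn_eq complex_norm_square[symmetric]
        power2_eq_square divide_simps mult.commute)
  then have "cmod (cinner x y) = inner (u *\<^sub>C x) y"
    by (simp add: inner_eq_Re_cinner)
  also have "\<dots> \<le> norm (u *\<^sub>C x) * norm y"
    by (rule norm_cauchy_schwarz)
  finally show ?thesis
    by (simp add: norm_scaleC u)
qed simp


section \<open>Bounded complex-linear operators\<close>

text \<open>
  The algebra \<open>L(H)\<close> consists of those bounded real-linear maps that are complex-linear; it carries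
  the operator norm and the product \<open>(o\<^sub>L)\<close> of the type of bounded linear functions.
\<close>

definition bounded_ops :: "('a::complex_hilbert \<Rightarrow>\<^sub>L 'a) set" where
  "bounded_ops = {T :: 'a \<Rightarrow>\<^sub>L 'a. \<forall>c x. T (c *\<^sub>C x) = c *\<^sub>C T x}"

lift_definition op_scaleC :: "complex \<Rightarrow> ('a \<Rightarrow>\<^sub>L 'a) \<Rightarrow> ('a::complex_hilbert \<Rightarrow>\<^sub>L 'a)"
  is "\<lambda>c T x. c *\<^sub>C T x"
  by (rule bounded_linear_compose[OF bounded_linear_scaleC])

text \<open>The operator \<open>\<langle>\<cdot>, g\<rangle> f\<close>.\<close>

lift_definition rank_one :: "'a \<Rightarrow> 'a \<Rightarrow> ('a::complex_hilbert \<Rightarrow>\<^sub>L 'a)"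
  is "\<lambda>f g x. cinner x g *\<^sub>C f"
proof -
  fix f g :: 'a
  show "bounded_linear (\<lambda>x. cinner x g *\<^sub>C f)"
  proof (rule bounded_linear_intro[where K = "norm g * norm f"])
    show "cinner (r *\<^sub>R x) g *\<^sub>C f = r *\<^sub>R cinner x g *\<^sub>C f" for r and x :: 'a
      by (metis cinner_scaleC_left scaleC_of_real scaleC_scaleC)
    show "norm (cinner x g *\<^sub>C f) \<le> norm x * (norm g * norm f)" for x
      using mult_right_mono[OF norm_cinner_le[of x g] norm_ge_zero[of f]]
      by (simp add: norm_scaleC mult.assoc)
  qed (simp add: cinner_add_left scaleC_add_left)
qed

definition is_adjoint :: "('a::complex_hilbert \<Rightarrow>\<^sub>L 'a) \<Rightarrow> ('a \<Rightarrow>\<^sub>L 'a) \<Rightarrow> bool" where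
  "is_adjoint T T' \<longleftrightarrow> T' \<in> bounded_ops \<and> (\<forall>x y. cinner (T x) y = cinner x (T' y))"

definition adjoint_op :: "('a::complex_hilbert \<Rightarrow>\<^sub>L 'a) \<Rightarrow> ('a \<Rightarrow>\<^sub>L 'a)" where
  "adjoint_op T = (THE T'. is_adjoint T T')"

definition selfadjoint_op :: "('a::complex_hilbert \<Rightarrow>\<^sub>L 'a) \<Rightarrow> bool" where
  "selfadjoint_op T \<longleftrightarrow> is_adjoint T T"

definition compact_op :: "('a::complex_hilbert \<Rightarrow>\<^sub>L 'a) \<Rightarrow> bool" where
  "compact_op T \<longleftrightarrow> compact (closure (blinfun_apply T ` cball 0 1))"

text \<open>\<open>\<langle>Sx, x\<rangle> > 0\<close> includes that the value is real.\<close>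

definition positive_op :: "('a::complex_hilbert \<Rightarrow>\<^sub>L 'a) \<Rightarrow> bool" where
  "positive_op S \<longleftrightarrow> (\<forall>x. x \<noteq> 0 \<longrightarrow> cinner (S x) x \<in> \<real> \<and> Re (cinner (S x) x) > 0)"

definition op_spectrum :: "('a::complex_hilbert \<Rightarrow>\<^sub>L 'a) \<Rightarrow> complex set" where
  "op_spectrum T = {z. \<not> (\<exists>R\<in>bounded_ops. R o\<^sub>L (T - op_scaleC z id_blinfun) = id_blinfun \<and>
                                          (T - op_scaleC z id_blinfun) o\<^sub>L R = id_blinfun)}"

definition op_power :: "('a::complex_hilbert \<Rightarrow>\<^sub>L 'a) \<Rightarrow> nat \<Rightarrow> ('a \<Rightarrow>\<^sub>L 'a)" where
  "op_power T n = (((o\<^sub>L) T) ^^ n) id_blinfun"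

definition op_poly :: "complex poly \<Rightarrow> ('a::complex_hilbert \<Rightarrow>\<^sub>L 'a) \<Rightarrow> ('a \<Rightarrow>\<^sub>L 'a)" where
  "op_poly p T = (\<Sum>i\<le>degree p. op_scaleC (coeff p i) (op_power T i))"


section \<open>Eigenvalue lists of symmetrizable operators\<close>

text \<open>
  \<open>(lam n)\<close>, \<open>n \<in> N\<close>, lists the non-zero eigenvalues of \<open>K\<close> with multiplicity; \<open>N\<close> is an initial
  segment of the natural numbers or all of them. Every non-zero complex number occurs as often as
  the complex dimension of its eigenspace (zero times if it is no eigenvalue). The normalization
  is \<open>\<langle>\<surd>S f\<^sub>k, \<surd>S f\<^sub>l\<rangle> = \<langle>f\<^sub>k, S f\<^sub>l\<rangle> = \<delta>\<^sub>k\<^sub>l\<close>.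
\<close>

definition eigen_list ::
  "('a::complex_hilbert \<Rightarrow>\<^sub>L 'a) \<Rightarrow> ('a \<Rightarrow>\<^sub>L 'a) \<Rightarrow> nat set \<Rightarrow> (nat \<Rightarrow> real) \<Rightarrow> (nat \<Rightarrow> 'a) \<Rightarrow> (nat \<Rightarrow> 'a) \<Rightarrow> bool"
where
  "eigen_list S K N lam f g \<longleftrightarrow>
     (N = UNIV \<or> (\<exists>m. N = {..<m})) \<and>
     (\<forall>n\<in>N. lam n \<noteq> 0) \<and>
     (\<forall>z::complex. z \<noteq> 0 \<longrightarrow>
        finite {n\<in>N. complex_of_real (lam n) = z} \<and>
        card {n\<in>N. complex_of_real (lam n) = z} = complex_vector.dim {x. K x = z *\<^sub>C x}) \<and>
     (\<forall>n\<in>N. adjoint_op K (f n) = complex_of_real (lam n) *\<^sub>C f n) \<and>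
     (\<forall>n\<in>N. g n = S (f n)) \<and>
     (\<forall>n\<in>N. K (g n) = complex_of_real (lam n) *\<^sub>C g n) \<and>
     (\<forall>k\<in>N. \<forall>l\<in>N. cinner (f k) (g l) = (if k = l then 1 else 0))"


section \<open>The algebra of continuously differentiable functions on an interval\<close>

text \<open>
  Functions on \<open>[a,b]\<close> are represented by functions that are \<open>undefined\<close> off \<open>[a,b]\<close>, so that
  \<open>C1_norm\<close> is a norm and not only a seminorm; derivatives at the end points are one-sided.
\<close>

definition C1 :: "real \<Rightarrow> real \<Rightarrow> (real \<Rightarrow> complex) set" where
  "C1 a b = {\<phi> \<in> extensional {a..b}.
     \<exists>\<phi>'. (\<forall>t\<in>{a..b}. (\<phi> has_vector_derivative \<phi>' t) (at t within {a..b})) \<and>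
          continuous_on {a..b} \<phi>'}"

definition C1_norm :: "real \<Rightarrow> real \<Rightarrow> (real \<Rightarrow> complex) \<Rightarrow> real" where
  "C1_norm a b \<phi> =
     (SUP t\<in>{a..b}. cmod (\<phi> t)) +
     (SUP t\<in>{a..b}. cmod (vector_derivative \<phi> (at t within {a..b})))"

definition C1_unital_algebra_hom ::
  "real \<Rightarrow> real \<Rightarrow> ((real \<Rightarrow> complex) \<Rightarrow> ('a::complex_hilbert \<Rightarrow>\<^sub>L 'a)) \<Rightarrow> bool"
where
  "C1_unital_algebra_hom a b \<Phi> \<longleftrightarrow>
     (\<forall>\<phi>\<in>C1 a b. \<Phi> \<phi> \<in> bounded_ops) \<and>
     (\<forall>\<phi>\<in>C1 a b. \<forall>\<psi>\<in>C1 a b. \<Phi> (\<lambda>t\<in>{a..b}. \<phi> t + \<psi> t) = \<Phi> \<phi> + \<Phi> \<psi>) \<and>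
     (\<forall>c. \<forall>\<phi>\<in>C1 a b. \<Phi> (\<lambda>t\<in>{a..b}. c * \<phi> t) = op_scaleC c (\<Phi> \<phi>)) \<and>
     (\<forall>\<phi>\<in>C1 a b. \<forall>\<psi>\<in>C1 a b. \<Phi> (\<lambda>t\<in>{a..b}. \<phi> t * \<psi> t) = \<Phi> \<phi> o\<^sub>L \<Phi> \<psi>) \<and>
     \<Phi> (\<lambda>t\<in>{a..b}. 1) = id_blinfun"

definition C1_norm_continuous ::
  "real \<Rightarrow> real \<Rightarrow> ((real \<Rightarrow> complex) \<Rightarrow> ('a::complex_hilbert \<Rightarrow>\<^sub>L 'a)) \<Rightarrow> bool"
where
  "C1_norm_continuous a b \<Phi> \<longleftrightarrow>
     (\<forall>\<phi>\<in>C1 a b. \<forall>\<epsilon>>0. \<exists>\<delta>>0. \<forall>\<psi>\<in>C1 a b.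
        C1_norm a b (\<lambda>t\<in>{a..b}. \<psi> t - \<phi> t) < \<delta> \<longrightarrow> norm (\<Phi> \<psi> - \<Phi> \<phi>) < \<epsilon>)"

end

(*
  Put [x,y] = <S x, y> with seminorm |x| = sqrt [x,x]. The operator K* = A S is symmetric for [.,.],
  the f n are orthonormal for it, and |A S x| is controlled by |x| in the Hilbert space norm. Hence
  the coefficients phi(lam n) - phi(0) = O(lam n) can be written as lam n times a bounded sequence,
  and the partial sums of the series are bounded by a Bessel sum for [.,.]. Compactness of S makes
  the tails of these Bessel sums uniformly small on the unit ball, so the series converges in
  operator norm. The value Phi(t) = K* is the spectral theorem: the part of K* not captured by the
  f n would have a nonzero eigenvalue, contradicting the multiplicities. Polynomials follow since
  Phi is multiplicative.
*)

theory Submission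
  imports Defs
begin

section \<open>Operators on complex Hilbert spaces\<close>

text \<open>The norm |x| is not complete, and the \<open>f n\<close> need be neither orthogonal nor
  bounded in the Hilbert norm. Every estimate therefore makes the same detour: a combination of the
  \<open>f n\<close> is written as \<open>A o\<^sub>L S\<close> applied to another combination,
  which is measured in |.|, where the \<open>f n\<close> are orthonormal. The detour costs one
  factor \<open>lam n\<close>, and the Lipschitz bound at 0 contained in the C1 norm pays exactly
  for it. Incompleteness also shapes the spectral step: with T the diagonal operator of the
  \<open>lam n\<close>, the supremum defining the |.|-norm of the residual D = K* - T need not be
  attained. The relation T D = 0 gives D D = A S D, so D D factors through the compact S and turns a
  maximizing sequence into one with a limit point. The resulting eigenvector y of A S is carried to
  S y, an eigenvector of S A, whose multiplicities are prescribed; the contradiction needs a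
  finite-dimensional eigenspace, a second use of compactness. Infinite dimension puts 0 into the
  spectrum of S A, so that phi(0) is the value at a point of the interval.\<close>

lemma cinner_add_right: "cinner x (y + z) = cinner x y + cinner x (z::'a::complex_hilbert)"
  by (metis cinner_add_left cinner_commute complex_cnj_add)

lemma cinner_scaleC_right: "cinner x (c *\<^sub>C y) = cnj c * cinner x (y::'a::complex_hilbert)"
  by (metis cinner_commute cinner_scaleC_left complex_cnj_mult)

lemma cinner_eq_norm_power2: "cinner x x = complex_of_real ((norm (x::'a::complex_hilbert))\<^sup>2)"
proof (rule complex_eqI)
  show "Re (cinner x x) = Re (complex_of_real ((norm x)\<^sup>2))"
    by (simp add: inner_eq_Re_cinner[symmetric] power2_norm_eq_inner)
  show "Im (cinner x x) = Im (complex_of_real ((norm x)\<^sup>2))"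
    using arg_cong[OF cinner_commute[of x x], of Im] by simp
qed

lemma bounded_linear_cinner_left: "bounded_linear (\<lambda>x. cinner x (y::'a::complex_hilbert))"
proof (rule bounded_linear_intro[where K = "norm y"])
  show "cinner (r *\<^sub>R x) y = r *\<^sub>R cinner x y" for r and x :: 'a
    by (metis cinner_scaleC_left scaleC_of_real scaleR_conv_of_real)
qed (simp_all add: cinner_add_left norm_cinner_le)

lemma bounded_linear_cinner_right: "bounded_linear (\<lambda>y. cinner (x::'a::complex_hilbert) y)"
proof (rule bounded_linear_intro[where K = "norm x"])
  show "cinner x (r *\<^sub>R y) = r *\<^sub>R cinner x y" for r and y :: 'a
    by (metis cinner_scaleC_right complex_cnj_complex_of_real scaleC_of_real scaleR_conv_of_real)
  show "norm (cinner x y) \<le> norm y * norm x" for y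
    by (metis norm_cinner_le mult.commute)
qed (simp_all add: cinner_add_right)

lemmas cinner_zero_left [simp] = linear_0[OF bounded_linear.linear[OF bounded_linear_cinner_left]]
lemmas cinner_zero_right [simp] = linear_0[OF bounded_linear.linear[OF bounded_linear_cinner_right]]
lemmas cinner_diff_left = linear_diff[OF bounded_linear.linear[OF bounded_linear_cinner_left]]
lemmas cinner_diff_right = linear_diff[OF bounded_linear.linear[OF bounded_linear_cinner_right]]
lemmas cinner_sum_left = linear_sum[OF bounded_linear.linear[OF bounded_linear_cinner_left]]
lemmas cinner_sum_right = linear_sum[OF bounded_linear.linear[OF bounded_linear_cinner_right]]

lemma cinner_self_eq_0_iff [simp]: "cinner x x = 0 \<longleftrightarrow> x = (0::'a::complex_hilbert)"
  by (simp add: cinner_eq_norm_power2)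

lemma cinner_eqI: "(\<And>y. cinner x y = cinner x' y) \<Longrightarrow> x = (x'::'a::complex_hilbert)"
  by (metis cinner_diff_left cinner_self_eq_0_iff eq_iff_diff_eq_0)

lemma bounded_ops_scaleC: "T \<in> bounded_ops \<Longrightarrow> T (c *\<^sub>C x) = c *\<^sub>C T x"
  by (simp add: bounded_ops_def)

lemma bounded_ops_id [simp]: "id_blinfun \<in> bounded_ops"
  by (simp add: bounded_ops_def)

lemma bounded_ops_compose: "T \<in> bounded_ops \<Longrightarrow> U \<in> bounded_ops \<Longrightarrow> T o\<^sub>L U \<in> bounded_ops"
  by (simp add: bounded_ops_def)

lemma bounded_ops_add: "T \<in> bounded_ops \<Longrightarrow> U \<in> bounded_ops \<Longrightarrow> T + U \<in> bounded_ops"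
  by (simp add: bounded_ops_def blinfun.add_left scaleC_add_right)

lemma bounded_ops_op_scaleC: "T \<in> bounded_ops \<Longrightarrow> op_scaleC c T \<in> bounded_ops"
  by (simp add: bounded_ops_def op_scaleC.rep_eq scaleC_scaleC mult.commute)

lemma bounded_ops_rank_one [simp]: "rank_one f g \<in> bounded_ops"
  by (simp add: bounded_ops_def rank_one.rep_eq cinner_scaleC_left scaleC_scaleC)

lemma bounded_ops_zero [simp]: "0 \<in> bounded_ops"
  by (simp add: bounded_ops_def)

lemma bounded_ops_sum: "(\<And>i. i \<in> F \<Longrightarrow> T i \<in> bounded_ops) \<Longrightarrow> sum T F \<in> bounded_ops"
  by (induction F rule: infinite_finite_induct)
    (auto intro: bounded_ops_add simp: bounded_ops_zero)

text \<open>An intersection of equalizers of continuous maps; it carries complex linearity from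
  finite sums to their norm limits, the diagonal operators.\<close>

lemma closed_bounded_ops: "closed (bounded_ops :: ('a::complex_hilbert \<Rightarrow>\<^sub>L 'a) set)"
proof -
  have "bounded_linear (\<lambda>T::'a \<Rightarrow>\<^sub>L 'a. c *\<^sub>C blinfun_apply T x)" for c x
    by (rule bounded_linear_compose[OF bounded_linear_scaleC])
      (rule blinfun.bounded_linear_left)
  then have "closed {T::'a \<Rightarrow>\<^sub>L 'a. blinfun_apply T (c *\<^sub>C x) = c *\<^sub>C blinfun_apply T x}" for c x
    by (intro closed_Collect_eq linear_continuous_on blinfun.bounded_linear_left)
  then show ?thesis
    unfolding bounded_ops_def by (intro closed_Collect_all)
qed

lemma op_scaleC_add_left: "op_scaleC (c + d) T = op_scaleC c T + op_scaleC d T"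
  by (rule blinfun_eqI) (simp add: op_scaleC.rep_eq blinfun.add_left scaleC_add_left)

lemma op_scaleC_add_right: "op_scaleC c (T + U) = op_scaleC c T + op_scaleC c U"
  by (rule blinfun_eqI) (simp add: op_scaleC.rep_eq blinfun.add_left scaleC_add_right)

lemma op_scaleC_scaleC: "op_scaleC c (op_scaleC d T) = op_scaleC (c * d) T"
  by (rule blinfun_eqI) (simp add: op_scaleC.rep_eq scaleC_scaleC)

lemma op_scaleC_compose_right: "T \<in> bounded_ops \<Longrightarrow> T o\<^sub>L op_scaleC c U = op_scaleC c (T o\<^sub>L U)"
  by (rule blinfun_eqI) (simp add: op_scaleC.rep_eq bounded_ops_scaleC)

lemma op_scaleC_zero [simp]: "op_scaleC 0 T = 0"
  by (rule blinfun_eqI) (simp add: op_scaleC.rep_eq)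

lemma op_scaleC_one [simp]: "op_scaleC 1 T = T"
  by (rule blinfun_eqI) (simp add: op_scaleC.rep_eq)

lemma norm_op_scaleC_le: "norm (op_scaleC c T) \<le> cmod c * norm T"
  by (rule norm_blinfun_bound)
    (auto simp: op_scaleC.rep_eq norm_scaleC mult.assoc intro!: mult_left_mono norm_blinfun)

lemma bounded_linear_op_scaleC: "bounded_linear (op_scaleC c)"
proof (rule bounded_linear_intro[where K = "cmod c"])
  show "op_scaleC c (r *\<^sub>R T) = r *\<^sub>R op_scaleC c T" for r and T :: "'a \<Rightarrow>\<^sub>L 'a"
    by (rule blinfun_eqI) (simp add: op_scaleC.rep_eq blinfun.scaleR_left linear_scale
        bounded_linear.linear[OF bounded_linear_scaleC])
  show "norm (op_scaleC c T) \<le> norm T * cmod c" for T :: "'a \<Rightarrow>\<^sub>L 'a"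
    using norm_op_scaleC_le[of c T] by (simp add: mult.commute)
qed (rule op_scaleC_add_right)

lemma op_power_Suc: "op_power T (Suc n) = T o\<^sub>L op_power T n"
  by (simp add: op_power_def)

lemma op_power_0: "op_power T 0 = id_blinfun"
  by (simp add: op_power_def)

text \<open>Evaluates the definite description: an adjoint is unique because the inner product
  separates vectors, and a candidate such as \<open>A o\<^sub>L S\<close> for \<open>K\<close> only
  has to be checked.\<close>

lemma adjoint_op_eq:
  assumes "is_adjoint T U"
  shows "adjoint_op T = U"
  unfolding adjoint_op_def
proof (rule the_equality[where P = "is_adjoint T", OF assms])
  fix V assume "is_adjoint T V"
  with assms show "V = U"
    unfolding is_adjoint_def by (metis blinfun_eqI cinner_commute cinner_eqI)
qed

section \<open>Projections onto finite spans, finite nets and Riesz's finiteness argument\<close>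

lemma ex_projection_span_finite:
  fixes v :: "'a::complex_hilbert"
  assumes "finite B"
  shows "\<exists>w \<in> complex_vector.span B. \<forall>b\<in>B. cinner (v - w) b = 0"
  using assms
proof (induction arbitrary: v rule: finite_induct)
  case empty
  show ?case by (simp add: complex_vector.span_zero)
next
  case (insert b B)
  obtain wv where wv: "wv \<in> complex_vector.span B" "\<forall>x\<in>B. cinner (v - wv) x = 0"
    using insert.IH by blast
  obtain wb where wb: "wb \<in> complex_vector.span B" "\<forall>x\<in>B. cinner (b - wb) x = 0"
    using insert.IH by blast
  have ortho: "cinner u w = 0" if "\<forall>x\<in>B. cinner u x = 0" "w \<in> complex_vector.span B" for u w :: 'a
    using that(2) by (induction rule: complex_vector.span_induct_alt)
      (use that(1) in \<open>auto simp: cinner_add_right cinner_scaleC_right\<close>)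
  define e where "e = b - wb"
  \<comment> \<open>If \<open>b\<close> already lies in the span of \<open>B\<close>, then
    \<open>e = 0\<close>, division by zero gives \<open>c = 0\<close>, and \<open>w = wv\<close>
    still works.\<close>
  define c where "c = cinner (v - wv) e / cinner e e"
  define w where "w = wv + c *\<^sub>C e"
  have sub: "complex_vector.span B \<subseteq> complex_vector.span (insert b B)"
    by (rule complex_vector.span_mono) auto
  have "e \<in> complex_vector.span (insert b B)"
    unfolding e_def using sub wb
    by (blast intro: complex_vector.span_diff complex_vector.span_base)
  then have w: "w \<in> complex_vector.span (insert b B)"
    unfolding w_def using sub wv
    by (blast intro: complex_vector.span_add complex_vector.span_scale)
  have B: "cinner (v - w) x = 0" if "x \<in> B" for x
    using wv(2) wb(2) that unfolding w_def e_def[symmetric]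
    by (simp add: diff_diff_eq[symmetric] cinner_diff_left[of "v - wv"] cinner_scaleC_left)
  have "cinner (v - w) e = 0"
    unfolding w_def c_def
    by (simp add: diff_diff_eq[symmetric] cinner_diff_left[of "v - wv"] cinner_scaleC_left)
  moreover have "cinner (v - w) wb = 0"
    by (rule ortho) (use B wb in auto)
  ultimately have "cinner (v - w) b = 0"
    by (simp add: e_def cinner_diff_right)
  with B w show ?case by blast
qed

text \<open>Total boundedness of the compact image supplies centres that need not be values of
  \<open>T\<close>; each useful centre is replaced by a point of \<open>X\<close> whose image is
  within \<open>\<epsilon>/2\<close> of it. Net points inside \<open>X\<close> are what the Riesz
  argument pulls back to a subspace.\<close>

lemma compact_op_finite_net:
  fixes T :: "'a::complex_hilbert \<Rightarrow>\<^sub>L 'a"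
  assumes T: "compact_op T" and X: "X \<subseteq> cball 0 r" and "0 < r" "0 < \<epsilon>"
  shows "\<exists>F. finite F \<and> F \<subseteq> X \<and> (\<forall>x\<in>X. \<exists>y\<in>F. norm (T x - T y) < \<epsilon>)"
proof -
  define Q where "Q = (\<lambda>x. r *\<^sub>R x) ` closure (blinfun_apply T ` cball 0 1)"
  have Q: "compact Q"
    unfolding Q_def using T by (intro compact_scaling) (simp add: compact_op_def)
  have TX: "T x \<in> Q" if "x \<in> X" for x
  proof -
    have "norm x \<le> r" using X that by auto
    then have "x /\<^sub>R r \<in> cball 0 1"
      using \<open>0 < r\<close> by (simp add: divide_simps)
    then have "T (x /\<^sub>R r) \<in> closure (blinfun_apply T ` cball 0 1)"
      by (intro subsetD[OF closure_subset] imageI)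
    moreover have "T x = r *\<^sub>R T (x /\<^sub>R r)"
      using \<open>0 < r\<close> by (simp add: blinfun.scaleR_right)
    ultimately show ?thesis unfolding Q_def by (rule rev_image_eqI)
  qed
  have "\<exists>k. finite k \<and> Q \<subseteq> (\<Union>x\<in>k. ball x (\<epsilon>/2))"
    using Q \<open>0 < \<epsilon>\<close> unfolding compact_eq_totally_bounded by (meson half_gt_zero)
  then obtain k where k: "finite k" "Q \<subseteq> (\<Union>x\<in>k. ball x (\<epsilon>/2))" by blast
  define h where "h c = (SOME x. x \<in> X \<and> dist c (T x) < \<epsilon>/2)" for c
  define k' where "k' = {c\<in>k. \<exists>x\<in>X. dist c (T x) < \<epsilon>/2}"
  have h: "h c \<in> X \<and> dist c (T (h c)) < \<epsilon>/2" if "c \<in> k'" for c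
    unfolding h_def by (rule someI_ex) (use that in \<open>auto simp: k'_def\<close>)
  show ?thesis
  proof (intro exI[of _ "h ` k'"] conjI ballI)
    show "finite (h ` k')" using k by (simp add: k'_def)
    show "h ` k' \<subseteq> X" using h by blast
    fix x assume x: "x \<in> X"
    then obtain c where c: "c \<in> k" "dist c (T x) < \<epsilon>/2"
      using k(2) TX[OF x] by auto
    with x have "c \<in> k'" by (auto simp: k'_def)
    moreover have "dist (T x) (T (h c)) < \<epsilon>"
      using dist_triangle_half_r[OF c(2)] h[OF \<open>c \<in> k'\<close>] by blast
    ultimately show "\<exists>y\<in>h ` k'. norm (T x - T y) < \<epsilon>"
      by (auto simp: dist_norm)
  qed
qed

text \<open>Riesz: a finite net of the unit ball spans, since a unit vector orthogonal to the span
  has distance at least 1 from every point of the net.\<close>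

lemma finite_span_if_compact_bounded_below:
  fixes S A :: "'a::complex_hilbert \<Rightarrow>\<^sub>L 'a"
  assumes S: "compact_op S" and V: "complex_vector.subspace V" and "0 < c"
    and le: "\<And>x. x \<in> V \<Longrightarrow> norm x \<le> c * norm (S (A x))"
  obtains B where "finite B" "B \<subseteq> V" "V \<subseteq> complex_vector.span B"
proof -
  \<comment> \<open>Compactness is given for \<open>S\<close>, so the net is chosen for
    \<open>S\<close> on the image under \<open>A\<close> of the unit ball of \<open>V\<close>, and
    is pulled back along \<open>A\<close> afterwards.\<close>
  define X where "X = blinfun_apply A ` (V \<inter> cball 0 1)"
  have X: "X \<subseteq> cball 0 (norm A + 1)"
  proof
    fix z assume "z \<in> X"
    then obtain x where x: "z = A x" "norm x \<le> 1" by (auto simp: X_def)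
    have "norm z \<le> norm A * norm x"
      unfolding x by (rule norm_blinfun)
    also have "\<dots> \<le> norm A + 1"
      using x mult_left_le[of "norm x" "norm A"] by simp
    finally show "z \<in> cball 0 (norm A + 1)" by simp
  qed
  have pos: "0 < norm A + 1" "0 < 1 / c"
    using \<open>0 < c\<close> by (simp_all add: add_nonneg_pos)
  obtain F where F: "finite F" "F \<subseteq> X" "\<forall>x\<in>X. \<exists>y\<in>F. norm (S x - S y) < 1 / c"
    using compact_op_finite_net[OF S X pos] by (elim exE conjE)
  obtain B where B: "finite B" "B \<subseteq> V \<inter> cball 0 1" "F = blinfun_apply A ` B"
    using finite_subset_image[OF F(1) F(2)[unfolded X_def]] by metis
  have net: "\<exists>y\<in>B. norm (x - y) < 1" if "x \<in> V" "norm x \<le> 1" for x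
  proof -
    have "A x \<in> X" using that by (simp add: X_def)
    then obtain y where y: "y \<in> B" "norm (S (A x) - S (A y)) < 1 / c"
      using F(3) unfolding B(3) by blast
    have "x - y \<in> V" using that y B by (blast intro: complex_vector.subspace_diff V)
    from le[OF this] have "norm (x - y) \<le> c * norm (S (A x) - S (A y))"
      by (simp add: blinfun.diff_right)
    also have "\<dots> < 1"
      using y(2) \<open>0 < c\<close> by (simp add: field_simps)
    finally show ?thesis using y by blast
  qed
  have "V \<subseteq> complex_vector.span B"
  proof
    fix v assume v: "v \<in> V"
    obtain w where w: "w \<in> complex_vector.span B" "\<forall>b\<in>B. cinner (v - w) b = 0"
      using ex_projection_span_finite[OF B(1)] by blast
    have "complex_vector.span B \<subseteq> V"
      using B V by (intro complex_vector.span_minimal) auto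
    with v w V have u: "v - w \<in> V" by (blast intro: complex_vector.subspace_diff)
    have "v = w"
    proof (rule ccontr)
      assume "v \<noteq> w"
      define e where "e = complex_of_real (inverse (norm (v - w))) *\<^sub>C (v - w)"
      have e: "norm e = 1"
        using \<open>v \<noteq> w\<close> by (simp add: e_def norm_scaleC norm_inverse)
      have "e \<in> V"
        unfolding e_def by (rule complex_vector.subspace_scale[OF V u])
      then obtain y where y: "y \<in> B" "norm (e - y) < 1"
        using net e by (metis order_refl)
      have "cinner e y = 0"
        using w(2) y(1) unfolding e_def by (simp only: cinner_scaleC_left) simp
      then have "cinner (e - y) e = 1"
        using cinner_commute[of y e] e
        by (simp add: cinner_diff_left cinner_eq_norm_power2)
      then have "1 \<le> norm (e - y)"
        using norm_cinner_le[of "e - y" e] e by simp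
      with y show False by simp
    qed
    with w show "v \<in> complex_vector.span B" by simp
  qed
  with that B show thesis by blast
qed

section \<open>The inner product induced by a positive operator\<close>

locale positive_operator =
  fixes S :: "'a::complex_hilbert \<Rightarrow>\<^sub>L 'a"
  assumes S_ops: "S \<in> bounded_ops" and S_pos: "positive_op S"
begin

definition ip :: "'a \<Rightarrow> 'a \<Rightarrow> complex" where
  "ip x y = cinner (S x) y"

definition sq :: "'a \<Rightarrow> real" where
  "sq x = Re (ip x x)"

lemma ip_add_left: "ip (x + y) z = ip x z + ip y z"
  by (simp add: ip_def blinfun.add_right cinner_add_left)

lemma ip_diff_left: "ip (x - y) z = ip x z - ip y z"
  by (simp add: ip_def blinfun.diff_right cinner_diff_left)

lemma ip_add_right: "ip x (y + z) = ip x y + ip x z"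
  by (simp add: ip_def cinner_add_right)

lemma ip_diff_right: "ip x (y - z) = ip x y - ip x z"
  by (simp add: ip_def cinner_diff_right)

lemma ip_scaleC_left: "ip (c *\<^sub>C x) y = c * ip x y"
  by (simp add: ip_def bounded_ops_scaleC[OF S_ops] cinner_scaleC_left)

lemma ip_scaleC_right: "ip x (c *\<^sub>C y) = cnj c * ip x y"
  by (simp add: ip_def cinner_scaleC_right)

lemma ip_sum_left: "ip (\<Sum>i\<in>F. h i) y = (\<Sum>i\<in>F. ip (h i) y)"
  by (simp add: ip_def blinfun.sum_right cinner_sum_left)

lemma ip_sum_right: "ip x (\<Sum>i\<in>F. h i) = (\<Sum>i\<in>F. ip x (h i))"
  by (simp add: ip_def cinner_sum_right)

lemma ip_zero_left [simp]: "ip 0 y = 0"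
  by (simp add: ip_def blinfun.zero_right)

lemma ip_zero_right [simp]: "ip x 0 = 0"
  by (simp add: ip_def)

lemma ip_self: "ip x x = complex_of_real (sq x)"
  using S_pos unfolding positive_op_def sq_def ip_def
  by (cases "x = 0") (auto simp: blinfun.zero_right complex_is_Real_iff complex_eq_iff)

lemma sq_pos: "x \<noteq> 0 \<Longrightarrow> 0 < sq x"
  using S_pos by (auto simp: positive_op_def sq_def ip_def)

lemma sq_nonneg [simp]: "0 \<le> sq x"
proof (cases "x = 0")
  case False
  then show ?thesis using sq_pos less_imp_le by blast
qed (simp add: sq_def)

lemma sq_eq_0_iff [simp]: "sq x = 0 \<longleftrightarrow> x = 0"
proof (cases "x = 0")
  case False
  then show ?thesis using sq_pos[of x] by simp
qed (simp add: sq_def)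

text \<open>Polarization: positivity makes the quadratic form real, and its vanishing imaginary
  parts at \<open>x + y\<close> and \<open>x + \<i> *\<^sub>C y\<close> yield the two components of
  the identity. Self-adjointness of \<open>S\<close> is thus derived from
  \<open>positive_op\<close>.\<close>

lemma ip_commute: "ip x y = cnj (ip y x)"
proof -
  have "Im (ip (x + y) (x + y)) = 0" "Im (ip (x + \<i> *\<^sub>C y) (x + \<i> *\<^sub>C y)) = 0"
    "Im (ip x x) = 0" "Im (ip y y) = 0"
    by (simp_all only: ip_self Im_complex_of_real)
  then show ?thesis
    by (simp add: ip_add_left ip_add_right ip_scaleC_left ip_scaleC_right complex_eq_iff)
qed

lemma S_selfadjoint: "cinner (S x) y = cinner x (S y)"
  using ip_commute[of x y] cinner_commute[of x "S y"] by (simp add: ip_def)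

lemma sq_scaleC: "sq (c *\<^sub>C x) = (cmod c)\<^sup>2 * sq x"
proof -
  have "ip (c *\<^sub>C x) (c *\<^sub>C x) = complex_of_real ((cmod c)\<^sup>2 * sq x)"
    unfolding ip_scaleC_left ip_scaleC_right ip_self[of x] of_real_mult complex_norm_square
    by (simp only: mult_ac)
  then show ?thesis unfolding sq_def by (simp only: Re_complex_of_real)
qed

lemma sq_diff: "sq (x - y) = sq x - 2 * Re (ip x y) + sq y"
  using arg_cong[OF ip_commute[of x y], of Re]
  by (simp add: sq_def ip_diff_left ip_diff_right)

section \<open>Orthonormal families and norm comparison for the induced inner product\<close>

definition orthonormal :: "nat set \<Rightarrow> (nat \<Rightarrow> 'a) \<Rightarrow> bool" where
  "orthonormal N f \<longleftrightarrow> (\<forall>k\<in>N. \<forall>l\<in>N. ip (f k) (f l) = (if k = l then 1 else 0))"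

lemma sq_sum_orthonormal:
  assumes "orthonormal N f" "finite F" "F \<subseteq> N"
  shows "sq (\<Sum>n\<in>F. c n *\<^sub>C f n) = (\<Sum>n\<in>F. (cmod (c n))\<^sup>2)"
proof -
  have "ip (\<Sum>n\<in>F. c n *\<^sub>C f n) (\<Sum>n\<in>F. c n *\<^sub>C f n) =
      (\<Sum>m\<in>F. \<Sum>n\<in>F. cnj (c m) * (c n * ip (f n) (f m)))"
    by (simp add: ip_sum_left ip_sum_right ip_scaleC_left ip_scaleC_right sum_distrib_left)
  also have "\<dots> = (\<Sum>m\<in>F. \<Sum>n\<in>F. if n = m then c n * cnj (c n) else 0)"
    using assms by (intro sum.cong) (auto simp: orthonormal_def subset_iff)
  also have "\<dots> = complex_of_real (\<Sum>n\<in>F. (cmod (c n))\<^sup>2)"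
    using assms by (simp add: complex_norm_square[symmetric])
  finally show ?thesis unfolding sq_def by simp
qed

lemma Bessel:
  assumes "orthonormal N f" "finite F" "F \<subseteq> N"
  shows "(\<Sum>n\<in>F. (cmod (ip x (f n)))\<^sup>2) \<le> sq x"
proof -
  define y where "y = (\<Sum>n\<in>F. ip x (f n) *\<^sub>C f n)"
  have "ip x y = complex_of_real (\<Sum>n\<in>F. (cmod (ip x (f n)))\<^sup>2)"
    by (simp add: y_def ip_sum_right ip_scaleC_right complex_norm_square[symmetric] mult.commute[of "cnj _"])
  moreover have "sq y = (\<Sum>n\<in>F. (cmod (ip x (f n)))\<^sup>2)"
    unfolding y_def by (rule sq_sum_orthonormal[OF assms])
  ultimately show ?thesis
    using sq_nonneg[of "x - y"] by (simp add: sq_diff)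
qed

lemma ip_Cauchy_Schwarz: "(cmod (ip x y))\<^sup>2 \<le> sq x * sq y"
proof (cases "y = 0")
  case False
  define t where "t = ip x y / sq y"
  have t: "cmod t = cmod (ip x y) / sq y"
    by (simp add: t_def norm_divide)
  have "ip x (t *\<^sub>C y) = complex_of_real ((cmod (ip x y))\<^sup>2 / sq y)"
    by (simp add: ip_scaleC_right t_def complex_norm_square[symmetric]
        mult.commute[of "cnj _"])
  then have "0 \<le> sq x - (cmod (ip x y))\<^sup>2 / sq y"
    using sq_nonneg[of "x - t *\<^sub>C y"] False
    by (simp add: sq_diff sq_scaleC t power_divide power2_eq_square[of "sq y"])
  then show ?thesis
    using sq_pos[OF False] by (simp add: field_simps)
qed simp

lemma sq_le: "sq x \<le> norm S * (norm x)\<^sup>2"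
proof -
  have "sq x \<le> cmod (ip x x)"
    unfolding sq_def by (rule complex_Re_le_cmod)
  also have "\<dots> \<le> norm (S x) * norm x"
    unfolding ip_def by (rule norm_cinner_le)
  also have "\<dots> \<le> (norm S * norm x) * norm x"
    by (intro mult_right_mono norm_blinfun) simp
  finally show ?thesis by (simp add: power2_eq_square mult.assoc)
qed

text \<open>Cauchy-Schwarz for \<open>ip\<close> at \<open>x\<close> and \<open>S x\<close>, where
  \<open>ip x (S x)\<close> is the square of \<open>norm (S x)\<close>; one such square then
  cancels. This is the passage from \<open>sq\<close> back to the Hilbert norm, the analogue of
  bounding S x through the square root of S.\<close>

lemma norm_S_le: "(norm (S x))\<^sup>2 \<le> norm S * sq x"
proof (cases "S x = 0")
  case False
  have "(cmod (ip x (S x)))\<^sup>2 \<le> sq x * sq (S x)"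
    by (rule ip_Cauchy_Schwarz)
  also have "\<dots> \<le> sq x * (norm S * (norm (S x))\<^sup>2)"
    by (intro mult_left_mono sq_le) simp
  finally have "(norm (S x))\<^sup>2 * (norm (S x))\<^sup>2 \<le> (norm S * sq x) * (norm (S x))\<^sup>2"
    by (simp add: ip_def cinner_eq_norm_power2 power2_eq_square norm_mult mult_ac)
  then show ?thesis
    by (rule mult_right_le_imp_le) (use False in simp)
qed simp

text \<open>The maximum of \<open>sq (D x) / sq x\<close> need not be attained since \<open>sq\<close> is not complete, but \<open>D\<^sup>2\<close>
  maps a maximizing sequence to a sequence with a norm limit point, which is an eigenvector of
  \<open>D\<^sup>2\<close>.\<close>

lemma ex_eigenvector:
  fixes D U :: "'a \<Rightarrow>\<^sub>L 'a"
  assumes S: "compact_op S" and D_ops: "D \<in> bounded_ops"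
    and sym: "\<And>x y. ip (D x) y = ip x (D y)"
    and bound: "\<And>x. (norm (D x))\<^sup>2 \<le> C * sq x"
    and D_sq: "\<And>x. D (D x) = U (S (D x))" and "D \<noteq> 0"
  obtains \<mu> :: real and y where "\<mu> \<noteq> 0" "y \<noteq> 0" "D y = complex_of_real \<mu> *\<^sub>C y"
proof -
  obtain x0 where x0: "D x0 \<noteq> 0"
    using \<open>D \<noteq> 0\<close> by (metis blinfun_eqI zero_blinfun.rep_eq)
  then have "x0 \<noteq> 0" by (auto simp: blinfun.zero_right)
  have scale1: "sq (complex_of_real (1 / sqrt (sq x)) *\<^sub>C x) = 1" if "x \<noteq> 0" for x
    using sq_pos[OF that] by (simp add: sq_scaleC norm_divide power_divide that)
  have scaleD: "sq (D (complex_of_real (1 / sqrt (sq x)) *\<^sub>C x)) = sq (D x) / sq x" for x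
    by (simp add: bounded_ops_scaleC[OF D_ops] sq_scaleC norm_divide power_divide)
  \<comment> \<open>\<open>M\<close> is the square of the operator norm of \<open>D\<close> with
    respect to the norm induced by \<open>ip\<close>.\<close>
  define M where "M = (SUP x\<in>{x. sq x = 1}. sq (D x))"
  have bdd: "bdd_above ((\<lambda>x. sq (D x)) ` {x. sq x = 1})"
  proof (rule bdd_aboveI2[where M = "norm S * C"])
    fix x assume "x \<in> {x. sq x = 1}"
    then have "norm S * (norm (D x))\<^sup>2 \<le> norm S * C"
      using bound[of x] by (intro mult_left_mono) auto
    with sq_le[of "D x"] show "sq (D x) \<le> norm S * C" by linarith
  qed
  have D_le: "sq (D x) \<le> M * sq x" for x
  proof (cases "x = 0")
    case False
    have "sq (D x) / sq x \<le> M"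
      unfolding M_def scaleD[symmetric]
      by (rule cSUP_upper[OF _ bdd]) (use scale1[OF False] in simp)
    then show ?thesis using sq_pos[OF False] by (simp add: field_simps)
  qed (simp add: blinfun.zero_right sq_def)
  have "0 < M"
    using D_le[of x0] sq_pos[OF x0] sq_nonneg[of x0]
    by (smt (verit) mult_nonneg_nonneg mult_nonpos_nonneg)
  have "\<exists>x. sq x = 1 \<and> M - inverse (real (Suc k)) < sq (D x)" for k
  proof -
    have "M - inverse (real (Suc k)) < M" by simp
    then have "\<exists>x\<in>{x. sq x = 1}. M - inverse (real (Suc k)) < sq (D x)"
      unfolding M_def using scale1[OF \<open>x0 \<noteq> 0\<close>]
      by (subst (asm) less_cSUP_iff[OF _ bdd]) auto
    then show ?thesis by blast
  qed
  then obtain x where x: "\<And>k. sq (x k) = 1" "\<And>k. M - inverse (real (Suc k)) < sq (D (x k))"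
    by metis
  have Dx: "D (x k) \<in> cball 0 (sqrt C)" for k
    using bound[of "x k"] x(1)[of k] by (simp add: real_le_rsqrt)
  obtain r w where r: "strict_mono r" and lim: "(\<lambda>k. D (D (x (r k)))) \<longlonglongrightarrow> w"
  proof -
    \<comment> \<open>The vectors \<open>D (x k)\<close> lie in the ball of radius
      \<open>sqrt C\<close>, so \<open>D (D (x k)) = U (S (D (x k)))\<close> stays in this
      continuous image of a compact set.\<close>
    define Q where "Q = (\<lambda>z. U (sqrt C *\<^sub>R z)) ` closure (blinfun_apply S ` cball 0 1)"
    have "compact Q"
      unfolding Q_def using S
      by (intro compact_continuous_image linear_continuous_on)
        (auto simp: compact_op_def intro: blinfun.bounded_linear_right[THEN bounded_linear_compose]
          bounded_linear_scaleR_right)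
    moreover have "D (D (x k)) \<in> Q" for k
    proof -
      have "0 \<le> C"
        using bound[of "x k"] x(1)[of k] order_trans[OF zero_le_power2] by fastforce
      \<comment> \<open>For \<open>C = 0\<close> the normalization by \<open>sqrt C\<close> is
        impossible, but then \<open>D (x k) = 0\<close>.\<close>
      then consider "C = 0" | "0 < C" by linarith
      then have "\<exists>z\<in>cball 0 1. D (x k) = sqrt C *\<^sub>R z"
      proof cases
        case 1
        then show ?thesis using Dx[of k] by (intro bexI[of _ 0]) auto
      next
        case 2
        then show ?thesis
          using Dx[of k] by (intro bexI[of _ "D (x k) /\<^sub>R sqrt C"]) (auto simp: divide_simps)
      qed
      then obtain z where z: "z \<in> cball 0 1" "D (x k) = sqrt C *\<^sub>R z" by blast
      have "S z \<in> closure (blinfun_apply S ` cball 0 1)"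
        by (intro subsetD[OF closure_subset] imageI z)
      moreover have "D (D (x k)) = U (sqrt C *\<^sub>R S z)"
        by (simp only: D_sq[of "x k"]) (simp only: z(2) blinfun.scaleR_right)
      ultimately show ?thesis unfolding Q_def by (rule rev_image_eqI)
    qed
    ultimately show thesis
      unfolding compact_def
      by (elim allE[of _ "\<lambda>k. D (D (x k))"] impE) (auto simp: comp_def intro: that)
  qed
  \<comment> \<open>Expanding the square, and bounding \<open>sq (D (D (x k)))\<close> by
    \<open>M * sq (D (x k))\<close>, leaves \<open>M\<close> times the defect
    \<open>M - sq (D (x k))\<close> of the maximizing sequence.\<close>
  have diff_le: "sq (D (D (x k)) - complex_of_real M *\<^sub>C x k) \<le> M * inverse (real (Suc k))" for k
  proof -
    have "ip (D (D (x k))) (complex_of_real M *\<^sub>C x k) = complex_of_real (M * sq (D (x k)))"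
      by (simp add: ip_scaleC_right sym[of "D (x k)"] ip_self)
    then have "sq (D (D (x k)) - complex_of_real M *\<^sub>C x k)
        = sq (D (D (x k))) - 2 * (M * sq (D (x k))) + M\<^sup>2"
      using x(1)[of k] by (simp add: sq_diff sq_scaleC)
    also have "\<dots> \<le> M * (M - sq (D (x k)))"
      using D_le[of "D (x k)"] by (simp add: algebra_simps power2_eq_square)
    also have "\<dots> \<le> M * inverse (real (Suc k))"
      using x(2)[of k] \<open>0 < M\<close> by (intro mult_left_mono) auto
    finally show ?thesis .
  qed
  \<comment> \<open>A vector that is small for \<open>sq\<close> need not be small in norm; one
    application of \<open>D\<close> makes it so by \<open>bound\<close>.\<close>
  have "(\<lambda>k. D (D (D (x k)) - complex_of_real M *\<^sub>C x k)) \<longlonglongrightarrow> 0"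
  proof (rule tendsto_norm_zero_cancel, rule Lim_null_comparison)
    show "\<forall>\<^sub>F k in sequentially. norm (norm (D (D (D (x k)) - complex_of_real M *\<^sub>C x k)))
        \<le> sqrt (\<bar>C\<bar> * (M * inverse (real (Suc k))))"
    proof (rule always_eventually, rule allI)
      fix k
      let ?z = "D (D (x k)) - complex_of_real M *\<^sub>C x k"
      have "(norm (D ?z))\<^sup>2 \<le> \<bar>C\<bar> * sq ?z"
        by (rule order_trans[OF bound]) (intro mult_right_mono, auto)
      also have "\<dots> \<le> \<bar>C\<bar> * (M * inverse (real (Suc k)))"
        by (intro mult_left_mono diff_le) simp
      finally show "norm (norm (D ?z)) \<le> sqrt (\<bar>C\<bar> * (M * inverse (real (Suc k))))"
        by (simp add: real_le_rsqrt)
    qed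
    have "(\<lambda>k. sqrt (\<bar>C\<bar> * (M * inverse (real (Suc k))))) \<longlonglongrightarrow> sqrt (\<bar>C\<bar> * (M * 0))"
      by (intro tendsto_intros LIMSEQ_inverse_real_of_nat)
    then show "(\<lambda>k. sqrt (\<bar>C\<bar> * (M * inverse (real (Suc k))))) \<longlonglongrightarrow> 0" by simp
  qed
  \<comment> \<open>A second application of \<open>D\<close> leaves an expression in
    \<open>D (D (x (r k)))\<close> only, the sequence known to converge.\<close>
  from LIMSEQ_subseq_LIMSEQ[OF this r]
  have "(\<lambda>k. D (D (D (D (x (r k))) - complex_of_real M *\<^sub>C x (r k)))) \<longlonglongrightarrow> D 0"
    by (intro blinfun.tendsto tendsto_const) (simp add: comp_def)
  then have "(\<lambda>k. D (D (D (D (x (r k))))) - complex_of_real M *\<^sub>C D (D (x (r k)))) \<longlonglongrightarrow> 0"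
    by (simp add: blinfun.diff_right blinfun.zero_right bounded_ops_scaleC[OF D_ops])
  moreover have "(\<lambda>k. D (D (D (D (x (r k))))) - complex_of_real M *\<^sub>C D (D (x (r k)))) \<longlonglongrightarrow>
      D (D w) - complex_of_real M *\<^sub>C w"
    by (intro tendsto_diff blinfun.tendsto tendsto_const
        bounded_linear.tendsto[OF bounded_linear_scaleC] lim)
  ultimately have "0 = D (D w) - complex_of_real M *\<^sub>C w"
    by (rule LIMSEQ_unique)
  then have w: "D (D w) = complex_of_real M *\<^sub>C w"
    by (rule iffD2[OF eq_iff_diff_eq_0, OF HOL.sym])
  \<comment> \<open>\<open>sq (D (x k))\<close> is the value \<open>ip (D (D (x k))) (x k)\<close>;
    it tends to \<open>M > 0\<close> and is bounded by a multiple of the norm of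
    \<open>D (D (x k))\<close>, which therefore cannot tend to 0.\<close>
  have "w \<noteq> 0"
  proof
    assume "w = 0"
    have "(\<lambda>k. inverse (real (Suc (r k)))) \<longlonglongrightarrow> 0"
      using LIMSEQ_subseq_LIMSEQ[OF LIMSEQ_inverse_real_of_nat r] by (simp add: comp_def)
    then have "(\<lambda>k. M - inverse (real (Suc (r k)))) \<longlonglongrightarrow> M - 0"
      by (intro tendsto_diff tendsto_const)
    moreover have "(\<lambda>k. sqrt (norm S * (norm (D (D (x (r k)))))\<^sup>2)) \<longlonglongrightarrow> sqrt (norm S * (norm w)\<^sup>2)"
      by (intro tendsto_intros lim)
    moreover have "M - inverse (real (Suc k)) \<le> sqrt (norm S * (norm (D (D (x k))))\<^sup>2)" for k
    proof -
      have "sq (D (x k)) \<le> cmod (ip (D (D (x k))) (x k))"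
        unfolding sq_def sym[of "D (x k)" "x k"] by (rule complex_Re_le_cmod)
      also have "\<dots> \<le> sqrt (sq (D (D (x k))))"
        using ip_Cauchy_Schwarz[of "D (D (x k))" "x k"] x(1)[of k] by (simp add: real_le_rsqrt)
      also have "\<dots> \<le> sqrt (norm S * (norm (D (D (x k))))\<^sup>2)"
        by (intro real_sqrt_le_mono sq_le)
      finally show ?thesis using x(2)[of k] by linarith
    qed
    ultimately have "M - 0 \<le> sqrt (norm S * (norm w)\<^sup>2)"
      by (intro LIMSEQ_le) auto
    with \<open>w = 0\<close> \<open>0 < M\<close> show False by simp
  qed
  \<comment> \<open>The equation for \<open>w\<close> factors as (D - m)(D + m) w = 0: either (D +
    m) w is an eigenvector for m, or it vanishes and \<open>w\<close> is an eigenvector for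
    -m.\<close>
  define m where "m = sqrt M"
  have m: "0 < m" "complex_of_real M = complex_of_real m * complex_of_real m"
    using \<open>0 < M\<close> by (simp_all add: m_def flip: of_real_mult)
  define y where "y = D w + complex_of_real m *\<^sub>C w"
  have Dy: "D y = complex_of_real m *\<^sub>C y"
    by (simp add: y_def blinfun.add_right w bounded_ops_scaleC[OF D_ops] scaleC_add_right
        scaleC_scaleC m(2))
  show thesis
  proof (cases "y = 0")
    case False
    with Dy m(1) show thesis by (intro that[of m y]) auto
  next
    case True
    then have "D w = complex_of_real (- m) *\<^sub>C w"
      by (simp add: y_def eq_neg_iff_add_eq_0)
    with \<open>w \<noteq> 0\<close> m(1) show thesis by (intro that[of "- m" w]) auto
  qed
qed

end

section \<open>Diagonal operators over an eigensystem\<close>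

text \<open>A finite set containing \<open>F0\<close> exceeds it by a set disjoint from
  \<open>F0\<close>, so all sums over such sets lie within a third of the tolerance of the sum over
  \<open>F0\<close>; completeness does the rest.\<close>

lemma summable_on_CauchyI:
  fixes h :: "'i \<Rightarrow> 'b::banach"
  assumes "\<And>\<epsilon>. 0 < \<epsilon> \<Longrightarrow> \<exists>F0. finite F0 \<and> F0 \<subseteq> A \<and>
    (\<forall>F. finite F \<longrightarrow> F \<subseteq> A \<longrightarrow> F \<inter> F0 = {} \<longrightarrow> norm (sum h F) \<le> \<epsilon>)"
  shows "h summable_on A"
proof -
  have "\<exists>P. eventually P (finite_subsets_at_top A) \<and>
      (\<forall>x y. P x \<and> P y \<longrightarrow> dist (sum h x) (sum h y) < e)" if "0 < e" for e :: real
  proof -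
    obtain F0 where F0: "finite F0" "F0 \<subseteq> A"
      "\<And>F. finite F \<Longrightarrow> F \<subseteq> A \<Longrightarrow> F \<inter> F0 = {} \<Longrightarrow> norm (sum h F) \<le> e / 3"
      using assms[of "e / 3"] \<open>0 < e\<close> by auto
    define P where "P F \<longleftrightarrow> finite F \<and> F0 \<subseteq> F \<and> F \<subseteq> A" for F
    have ev: "eventually P (finite_subsets_at_top A)"
      unfolding eventually_finite_subsets_at_top P_def using F0 by blast
    have near: "dist (sum h F) (sum h F0) \<le> e / 3" if "P F" for F
    proof -
      have "sum h F - sum h F0 = sum h (F - F0)"
        using that F0(1) unfolding P_def by (subst sum_diff) auto
      moreover have "norm (sum h (F - F0)) \<le> e / 3"
        by (rule F0(3)) (use that in \<open>auto simp: P_def\<close>)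
      ultimately show ?thesis by (simp add: dist_norm)
    qed
    have "dist (sum h x) (sum h y) < e" if "P x" "P y" for x y
      using dist_triangle2[of "sum h x" "sum h y" "sum h F0"] near[OF that(1)] near[OF that(2)]
        \<open>0 < e\<close> by linarith
    with ev show ?thesis by blast
  qed
  then have "cauchy_filter (filtermap (sum h) (finite_subsets_at_top A))"
    by (simp add: cauchy_filter_metric_filtermap)
  moreover have "complete (UNIV :: 'b set)"
    by (meson Cauchy_convergent UNIV_I complete_def convergent_def)
  ultimately obtain L where "(sum h \<longlongrightarrow> L) (finite_subsets_at_top A)"
    using complete_uniform[where S = UNIV] by (force simp add: filterlim_def)
  then show ?thesis
    using summable_on_def has_sum_def by blast
qed

locale symmetrizable = positive_operator S for S :: "'a::complex_hilbert \<Rightarrow>\<^sub>L 'a" +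
  fixes A :: "'a \<Rightarrow>\<^sub>L 'a"
  assumes S_compact: "compact_op S"
    and A_ops: "A \<in> bounded_ops" and A_selfadjoint: "\<And>x y. cinner (A x) y = cinner x (A y)"
begin

lemma ip_AS: "ip (A (S x)) y = ip x (A (S y))"
  by (simp add: ip_def S_selfadjoint A_selfadjoint)

text \<open>A bound for A S as a map from the norm induced by \<open>ip\<close> to the Hilbert norm;
  the factor \<open>sqrt (norm S)\<close> is that of \<open>norm_S_le\<close>.\<close>

definition opc :: real where
  "opc = norm A * sqrt (norm S)"

lemma opc_nonneg [simp]: "0 \<le> opc"
  by (simp add: opc_def)

lemma norm_AS_le: "norm (A (S x)) \<le> opc * sqrt (sq x)"
proof -
  have "norm (S x) \<le> sqrt (norm S) * sqrt (sq x)"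
    using norm_S_le[of x] by (simp add: real_le_rsqrt flip: real_sqrt_mult)
  then have "norm A * norm (S x) \<le> opc * sqrt (sq x)"
    unfolding opc_def by (simp add: mult.assoc mult_left_mono)
  then show ?thesis using norm_blinfun[of A "S x"] by linarith
qed

lemma is_adjoint_SA: "is_adjoint (S o\<^sub>L A) (A o\<^sub>L S)"
  unfolding is_adjoint_def
  by (simp add: bounded_ops_compose A_ops S_ops S_selfadjoint A_selfadjoint)

end

text \<open>An arbitrary orthonormal family of eigenvectors; its completeness enters only with
  \<open>AS_eq_diagonal\<close>.\<close>

locale eigensystem = symmetrizable S A for S A :: "'a::complex_hilbert \<Rightarrow>\<^sub>L 'a" +
  fixes N :: "nat set" and lam :: "nat \<Rightarrow> real" and f :: "nat \<Rightarrow> 'a"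
  assumes f_orthonormal: "orthonormal N f"
    and lam_nonzero: "\<And>n. n \<in> N \<Longrightarrow> lam n \<noteq> 0"
    and AS_f: "\<And>n. n \<in> N \<Longrightarrow> A (S (f n)) = complex_of_real (lam n) *\<^sub>C f n"
begin

abbreviation P :: "nat \<Rightarrow> 'a \<Rightarrow>\<^sub>L 'a" where
  "P n \<equiv> rank_one (f n) (S (f n))"

lemma P_apply: "P n x = ip x (f n) *\<^sub>C f n"
  by (simp add: rank_one.rep_eq ip_def S_selfadjoint)

lemma ip_f: "k \<in> N \<Longrightarrow> l \<in> N \<Longrightarrow> ip (f k) (f l) = (if k = l then 1 else 0)"
  using f_orthonormal by (simp add: orthonormal_def)

section \<open>Uniformly small tails of the coordinates\<close>

definition coord_norm :: "nat set \<Rightarrow> 'a \<Rightarrow> real" where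
  "coord_norm F x = L2_set (\<lambda>n. cmod (ip x (f n))) F"

lemma coord_norm_le:
  assumes "finite F" "F \<subseteq> N"
  shows "coord_norm F x \<le> sqrt (sq x)"
  unfolding coord_norm_def L2_set_def using Bessel[OF f_orthonormal assms] by simp

text \<open>Since \<open>\<alpha> n *\<^sub>C f n\<close> is \<open>\<alpha> n / lam n\<close> times
  \<open>A (S (f n))\<close>, the sum is A S of a combination whose coefficients are at most
  \<open>M\<close> times the coordinates of \<open>x\<close>; \<open>norm_AS_le\<close> then reduces
  everything to an orthonormal sum.\<close>

lemma norm_sum_diagonal_le:
  assumes F: "finite F" "F \<subseteq> N" and "0 \<le> M"
    and \<alpha>: "\<And>n. n \<in> N \<Longrightarrow> cmod (\<alpha> n) \<le> M * \<bar>lam n\<bar>"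
  shows "norm ((\<Sum>n\<in>F. op_scaleC (\<alpha> n) (P n)) x) \<le> opc * (M * coord_norm F x)"
proof -
  define c where "c n = \<alpha> n / complex_of_real (lam n) * ip x (f n)" for n
  have "c n * complex_of_real (lam n) = \<alpha> n * ip x (f n)" if "n \<in> N" for n
    using lam_nonzero[OF that] by (simp add: c_def)
  then have "(\<Sum>n\<in>F. op_scaleC (\<alpha> n) (P n)) x = A (S (\<Sum>n\<in>F. c n *\<^sub>C f n))"
    using F by (auto simp: blinfun.sum_left blinfun.sum_right op_scaleC.rep_eq P_apply
        bounded_ops_scaleC[OF S_ops] bounded_ops_scaleC[OF A_ops] AS_f scaleC_scaleC subset_iff
        intro!: sum.cong)
  then have "norm ((\<Sum>n\<in>F. op_scaleC (\<alpha> n) (P n)) x) \<le> opc * sqrt (\<Sum>n\<in>F. (cmod (c n))\<^sup>2)"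
    using norm_AS_le[of "\<Sum>n\<in>F. c n *\<^sub>C f n"]
    by (simp add: sq_sum_orthonormal[OF f_orthonormal F])
  also have "sqrt (\<Sum>n\<in>F. (cmod (c n))\<^sup>2) \<le> L2_set (\<lambda>n. M * cmod (ip x (f n))) F"
    unfolding L2_set_def[symmetric]
  proof (rule L2_set_mono)
    fix n assume "n \<in> F"
    then have n: "n \<in> N" using F by auto
    have "cmod (\<alpha> n) / \<bar>lam n\<bar> \<le> M"
      using \<alpha>[OF n] lam_nonzero[OF n] by (simp add: field_simps)
    then show "cmod (c n) \<le> M * cmod (ip x (f n))"
      using mult_right_mono[of _ _ "cmod (ip x (f n))"]
      by (fastforce simp: c_def norm_mult norm_divide)
  qed simp
  also have "\<dots> = M * coord_norm F x"
    unfolding coord_norm_def by (rule L2_set_right_distrib[symmetric]) fact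
  finally show ?thesis by (simp add: mult_left_mono)
qed

text \<open>The Bessel sum over \<open>F0\<close> is chosen within \<open>\<epsilon>\<^sup>2\<close>
  of the supremum of all Bessel sums, so a disjoint set can add no more than that.\<close>

lemma coord_norm_tail:
  assumes "0 < \<epsilon>"
  shows "\<exists>F0. finite F0 \<and> F0 \<subseteq> N \<and>
    (\<forall>F. finite F \<longrightarrow> F \<subseteq> N \<longrightarrow> F \<inter> F0 = {} \<longrightarrow> coord_norm F x \<le> \<epsilon>)"
proof -
  define s where "s F = (\<Sum>n\<in>F. (cmod (ip x (f n)))\<^sup>2)" for F
  define FS where "FS = {F. finite F \<and> F \<subseteq> N}"
  have bdd: "bdd_above (s ` FS)"
    by (rule bdd_aboveI2[where M = "sq x"]) (auto simp: s_def FS_def intro: Bessel[OF f_orthonormal])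
  have "FS \<noteq> {}" unfolding FS_def by blast
  moreover have "Sup (s ` FS) - \<epsilon>\<^sup>2 < Sup (s ` FS)" using assms by simp
  ultimately obtain F0 where F0: "F0 \<in> FS" "Sup (s ` FS) - \<epsilon>\<^sup>2 < s F0"
    using less_cSUP_iff[OF _ bdd] by blast
  have "coord_norm F x \<le> \<epsilon>" if F: "finite F" "F \<subseteq> N" "F \<inter> F0 = {}" for F
  proof -
    have "s F0 + s F = s (F0 \<union> F)"
      unfolding s_def using F F0 by (intro sum.union_disjoint[symmetric]) (auto simp: FS_def)
    also have "\<dots> \<le> Sup (s ` FS)"
      by (rule cSUP_upper[OF _ bdd]) (use F F0 in \<open>auto simp: FS_def\<close>)
    finally have "s F \<le> \<epsilon>\<^sup>2" using F0 by linarith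
    then show ?thesis
      unfolding coord_norm_def L2_set_def s_def[symmetric] using assms
      by (simp add: real_le_lsqrt)
  qed
  with F0 show ?thesis unfolding FS_def by blast
qed

text \<open>The unit ball is totally bounded with respect to \<open>sq\<close> because \<open>S\<close> is compact.\<close>

lemma coord_norm_uniform_tail:
  assumes "0 < \<epsilon>"
  shows "\<exists>F0. finite F0 \<and> F0 \<subseteq> N \<and> (\<forall>F. finite F \<longrightarrow> F \<subseteq> N \<longrightarrow> F \<inter> F0 = {} \<longrightarrow>
    (\<forall>x\<in>cball 0 1. coord_norm F x \<le> \<epsilon>))"
proof -
  \<comment> \<open>Net points lie in the unit ball too, so \<open>norm (x - y) \<le> 2\<close> and
    \<open>\<epsilon>\<^sup>2 / 8\<close> gives
    \<open>sq (x - y) \<le> (\<epsilon> / 2)\<^sup>2\<close>; the other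
    \<open>\<epsilon> / 2\<close> is the tail at the net point \<open>y\<close>.\<close>
  have pos: "0 < (1::real)" "0 < \<epsilon>\<^sup>2 / 8" using assms by auto
  obtain X where X: "finite X" "X \<subseteq> cball 0 1"
    "\<forall>x\<in>cball 0 1. \<exists>y\<in>X. norm (S x - S y) < \<epsilon>\<^sup>2 / 8"
    using compact_op_finite_net[OF S_compact order_refl pos] by (elim exE conjE)
  have "\<forall>y. \<exists>F0. finite F0 \<and> F0 \<subseteq> N \<and>
      (\<forall>F. finite F \<longrightarrow> F \<subseteq> N \<longrightarrow> F \<inter> F0 = {} \<longrightarrow> coord_norm F y \<le> \<epsilon> / 2)"
    using coord_norm_tail[of "\<epsilon> / 2"] assms by simp
  from choice[OF this] obtain G where "\<forall>y. finite (G y) \<and> G y \<subseteq> N \<and>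
      (\<forall>F. finite F \<longrightarrow> F \<subseteq> N \<longrightarrow> F \<inter> G y = {} \<longrightarrow> coord_norm F y \<le> \<epsilon> / 2)"
    by (elim exE)
  then have G: "finite (G y)" "G y \<subseteq> N"
    "finite F \<Longrightarrow> F \<subseteq> N \<Longrightarrow> F \<inter> G y = {} \<Longrightarrow> coord_norm F y \<le> \<epsilon> / 2" for y F
    by simp_all
  have "coord_norm F x \<le> \<epsilon>"
    if F: "finite F" "F \<subseteq> N" "F \<inter> (\<Union>y\<in>X. G y) = {}" and x: "x \<in> cball 0 1" for F x
  proof -
    obtain y where y: "y \<in> X" "norm (S x - S y) < \<epsilon>\<^sup>2 / 8"
      using X(3) x by blast
    have "norm (x - y) \<le> 2"
      using norm_triangle_ineq4[of x y] x y(1) X(2) by auto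
    have "sq (x - y) \<le> cmod (cinner (S (x - y)) (x - y))"
      unfolding sq_def ip_def by (rule complex_Re_le_cmod)
    also have "\<dots> \<le> norm (S (x - y)) * norm (x - y)"
      by (rule norm_cinner_le)
    also have "\<dots> \<le> \<epsilon>\<^sup>2 / 8 * 2"
      by (rule mult_mono) (use y(2) \<open>norm (x - y) \<le> 2\<close> in \<open>auto simp: blinfun.diff_right\<close>)
    finally have "sq (x - y) \<le> (\<epsilon> / 2)\<^sup>2" by (simp add: power_divide)
    then have "sqrt (sq (x - y)) \<le> \<epsilon> / 2" using assms by (intro real_le_lsqrt) auto
    then have 1: "coord_norm F (x - y) \<le> \<epsilon> / 2"
      using coord_norm_le[OF F(1,2), of "x - y"] by linarith
    have 2: "coord_norm F y \<le> \<epsilon> / 2"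
      by (rule G(3)[OF F(1,2)]) (use F(3) y(1) in blast)
    have "coord_norm F x \<le> L2_set (\<lambda>n. cmod (ip (x - y) (f n)) + cmod (ip y (f n))) F"
      unfolding coord_norm_def
    proof (rule L2_set_mono)
      show "cmod (ip x (f n)) \<le> cmod (ip (x - y) (f n)) + cmod (ip y (f n))" for n
        using norm_triangle_ineq[of "ip (x - y) (f n)" "ip y (f n)"]
        by (simp add: ip_diff_left)
    qed simp
    also have "\<dots> \<le> coord_norm F (x - y) + coord_norm F y"
      unfolding coord_norm_def by (rule L2_set_triangle_ineq)
    finally show ?thesis using 1 2 by linarith
  qed
  then show ?thesis
    using X(1) G(1) subsetD[OF G(2)] by (intro exI[of _ "\<Union>y\<in>X. G y"]) auto
qed

section \<open>Diagonal operators as unconditional norm limits\<close>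

definition dominated :: "real \<Rightarrow> (nat \<Rightarrow> complex) \<Rightarrow> bool" where
  "dominated M \<alpha> \<longleftrightarrow> 0 \<le> M \<and> (\<forall>n\<in>N. cmod (\<alpha> n) \<le> M * \<bar>lam n\<bar>)"

text \<open>\<open>infsum\<close> is total and returns 0 when the family is not summable, so the
  properties below are stated under \<open>dominated\<close> or for a given
  \<open>has_sum\<close>.\<close>

definition diagonal :: "(nat \<Rightarrow> complex) \<Rightarrow> 'a \<Rightarrow>\<^sub>L 'a" where
  "diagonal \<alpha> = infsum (\<lambda>n. op_scaleC (\<alpha> n) (P n)) N"

lemma diagonal_has_sum:
  assumes "dominated M \<alpha>"
  shows "((\<lambda>n. op_scaleC (\<alpha> n) (P n)) has_sum diagonal \<alpha>) N"
proof -
  have M: "0 \<le> M" and \<alpha>: "\<And>n. n \<in> N \<Longrightarrow> cmod (\<alpha> n) \<le> M * \<bar>lam n\<bar>"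
    using assms by (auto simp: dominated_def)
  have "(\<lambda>n. op_scaleC (\<alpha> n) (P n)) summable_on N"
  proof (rule summable_on_CauchyI)
    fix \<epsilon> :: real assume "0 < \<epsilon>"
    \<comment> \<open>The summand 1 keeps the denominator positive when
      \<open>opc * M = 0\<close>.\<close>
    define \<delta> where "\<delta> = \<epsilon> / (opc * M + 1)"
    have den: "0 < opc * M + 1"
      using M by (simp add: add_nonneg_pos)
    have "0 < \<delta>" using \<open>0 < \<epsilon>\<close> den by (simp add: \<delta>_def)
    have \<delta>: "opc * (M * \<delta>) \<le> \<epsilon>"
      using den \<open>0 < \<epsilon>\<close> M by (simp add: \<delta>_def field_simps)
    obtain F0 where F0: "finite F0" "F0 \<subseteq> N"
      "\<forall>F. finite F \<longrightarrow> F \<subseteq> N \<longrightarrow> F \<inter> F0 = {} \<longrightarrow> (\<forall>x\<in>cball 0 1. coord_norm F x \<le> \<delta>)"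
      using coord_norm_uniform_tail[OF \<open>0 < \<delta>\<close>] by (elim exE conjE)
    have "norm (\<Sum>n\<in>F. op_scaleC (\<alpha> n) (P n)) \<le> \<epsilon>"
      if F: "finite F" "F \<subseteq> N" "F \<inter> F0 = {}" for F
    proof -
      let ?T = "\<Sum>n\<in>F. op_scaleC (\<alpha> n) (P n)"
      have unit: "norm (?T x) \<le> \<epsilon>" if "norm x \<le> 1" for x
      proof -
        have "norm (?T x) \<le> opc * (M * coord_norm F x)"
          by (rule norm_sum_diagonal_le[OF F(1,2) M \<alpha>])
        also have "\<dots> \<le> opc * (M * \<delta>)"
          using M that F F0(3) by (intro mult_left_mono) auto
        finally show ?thesis using \<delta> by linarith
      qed
      show ?thesis
      proof (rule norm_blinfun_bound)
        show "0 \<le> \<epsilon>" using \<open>0 < \<epsilon>\<close> by simp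
        show "norm (?T x) \<le> \<epsilon> * norm x" for x
        proof (cases "x = 0")
          case False
          then show ?thesis
            using unit[of "x /\<^sub>R norm x"] by (simp add: blinfun.scaleR_right field_simps)
        qed (simp add: blinfun.zero_right)
      qed
    qed
    with F0(1,2) show "\<exists>F0. finite F0 \<and> F0 \<subseteq> N \<and> (\<forall>F. finite F \<longrightarrow> F \<subseteq> N \<longrightarrow> F \<inter> F0 = {} \<longrightarrow>
        norm (\<Sum>n\<in>F. op_scaleC (\<alpha> n) (P n)) \<le> \<epsilon>)"
      by blast
  qed
  then show ?thesis unfolding diagonal_def by (rule has_sum_infsum)
qed

lemma diagonal_eqI: "((\<lambda>n. op_scaleC (\<alpha> n) (P n)) has_sum T) N \<Longrightarrow> diagonal \<alpha> = T"
  unfolding diagonal_def by (rule infsumI)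

lemma diagonal_ops:
  assumes "dominated M \<alpha>"
  shows "diagonal \<alpha> \<in> bounded_ops"
proof (rule Lim_in_closed_set[OF closed_bounded_ops])
  show "\<forall>\<^sub>F F in finite_subsets_at_top N. (\<Sum>n\<in>F. op_scaleC (\<alpha> n) (P n)) \<in> bounded_ops"
    by (intro always_eventually allI bounded_ops_sum bounded_ops_op_scaleC bounded_ops_rank_one)
  show "((\<lambda>F. \<Sum>n\<in>F. op_scaleC (\<alpha> n) (P n)) \<longlongrightarrow> diagonal \<alpha>) (finite_subsets_at_top N)"
    using diagonal_has_sum[OF assms] by (simp add: has_sum_def)
qed simp

text \<open>A bound by \<open>sq x\<close> instead of \<open>norm x\<close> is what
  \<open>ex_eigenvector\<close> asks of the residual operator; it survives the limit because
  Bessel's inequality is uniform in \<open>F\<close>.\<close>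

lemma norm_diagonal_apply_le:
  assumes "dominated M \<alpha>"
  shows "norm (diagonal \<alpha> x) \<le> opc * (M * sqrt (sq x))"
proof (rule tendsto_upperbound)
  have "((\<lambda>F. \<Sum>n\<in>F. op_scaleC (\<alpha> n) (P n)) \<longlongrightarrow> diagonal \<alpha>) (finite_subsets_at_top N)"
    using diagonal_has_sum[OF assms] by (simp add: has_sum_def)
  then show "((\<lambda>F. norm ((\<Sum>n\<in>F. op_scaleC (\<alpha> n) (P n)) x)) \<longlongrightarrow> norm (diagonal \<alpha> x))
      (finite_subsets_at_top N)"
    by (intro tendsto_norm blinfun.tendsto tendsto_const)
  show "\<forall>\<^sub>F F in finite_subsets_at_top N.
      norm ((\<Sum>n\<in>F. op_scaleC (\<alpha> n) (P n)) x) \<le> opc * (M * sqrt (sq x))"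
  proof (rule eventually_finite_subsets_at_top_weakI)
    fix F assume F: "finite F" "F \<subseteq> N"
    have "norm ((\<Sum>n\<in>F. op_scaleC (\<alpha> n) (P n)) x) \<le> opc * (M * coord_norm F x)"
      using assms by (intro norm_sum_diagonal_le F) (auto simp: dominated_def)
    also have "\<dots> \<le> opc * (M * sqrt (sq x))"
      using assms by (intro mult_left_mono coord_norm_le F) (auto simp: dominated_def)
    finally show "norm ((\<Sum>n\<in>F. op_scaleC (\<alpha> n) (P n)) x) \<le> opc * (M * sqrt (sq x))" .
  qed
qed simp

lemma norm_diagonal_le:
  assumes "dominated M \<alpha>"
  shows "norm (diagonal \<alpha>) \<le> opc * sqrt (norm S) * M"
proof (rule norm_blinfun_bound)
  have M: "0 \<le> M" using assms by (simp add: dominated_def)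
  then show "0 \<le> opc * sqrt (norm S) * M" by simp
  fix x
  have "sqrt (sq x) \<le> sqrt (norm S) * norm x"
    using sq_le[of x] by (intro real_le_lsqrt) (auto simp: power_mult_distrib)
  then have "opc * (M * sqrt (sq x)) \<le> opc * (M * (sqrt (norm S) * norm x))"
    using M by (intro mult_left_mono) auto
  with norm_diagonal_apply_le[OF assms, of x]
  show "norm (diagonal \<alpha> x) \<le> opc * sqrt (norm S) * M * norm x"
    by (simp add: mult_ac)
qed

lemma diagonal_f:
  assumes "dominated M \<alpha>" and m: "m \<in> N"
  shows "diagonal \<alpha> (f m) = \<alpha> m *\<^sub>C f m"
proof -
  have "((\<lambda>n. op_scaleC (\<alpha> n) (P n) (f m)) has_sum diagonal \<alpha> (f m)) N"
    by (rule has_sum_bounded_linear[OF blinfun.bounded_linear_left diagonal_has_sum[OF assms(1)]])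
  moreover have "((\<lambda>n. op_scaleC (\<alpha> n) (P n) (f m)) has_sum \<alpha> m *\<^sub>C f m) N"
    by (rule has_sum_finite_neutralI[where B = "{m}"])
      (use m in \<open>auto simp: op_scaleC.rep_eq P_apply ip_f\<close>)
  ultimately show ?thesis by (rule has_sum_unique)
qed

lemma compose_P_eq:
  assumes "T \<in> bounded_ops" "T (f n) = c *\<^sub>C f n"
  shows "T o\<^sub>L P n = op_scaleC c (P n)"
  by (rule blinfun_eqI)
    (simp add: P_apply bounded_ops_scaleC[OF assms(1)] assms(2) op_scaleC.rep_eq scaleC_scaleC
      mult.commute)

lemma diagonal_compose_left:
  assumes T: "T \<in> bounded_ops" "\<And>n. n \<in> N \<Longrightarrow> T (f n) = c n *\<^sub>C f n"
    and \<beta>: "dominated M \<beta>"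
  shows "T o\<^sub>L diagonal \<beta> = diagonal (\<lambda>n. c n * \<beta> n)"
proof -
  have "((\<lambda>n. T o\<^sub>L op_scaleC (\<beta> n) (P n)) has_sum T o\<^sub>L diagonal \<beta>) N"
    by (rule has_sum_bounded_linear[OF bounded_bilinear.bounded_linear_right
          [OF bounded_bilinear_blinfun_compose] diagonal_has_sum[OF \<beta>]])
  also have "?this \<longleftrightarrow> ((\<lambda>n. op_scaleC (c n * \<beta> n) (P n)) has_sum T o\<^sub>L diagonal \<beta>) N"
    by (intro has_sum_cong)
      (simp add: op_scaleC_compose_right[OF T(1)] compose_P_eq[OF T] op_scaleC_scaleC mult.commute)
  finally show ?thesis by (rule diagonal_eqI[symmetric])
qed

lemma dominated_lam: "dominated 1 (\<lambda>n. complex_of_real (lam n))"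
  by (simp add: dominated_def)

lemma ip_diagonal_lam:
  "ip (diagonal (\<lambda>n. complex_of_real (lam n)) x) y = ip x (diagonal (\<lambda>n. complex_of_real (lam n)) y)"
proof -
  let ?T = "diagonal (\<lambda>n. complex_of_real (lam n))"
  let ?h = "\<lambda>n. op_scaleC (complex_of_real (lam n)) (P n)"
  have T: "(?h has_sum ?T) N" by (rule diagonal_has_sum[OF dominated_lam])
  have "((\<lambda>n. ip (?h n x) y) has_sum ip (?T x) y) N"
    unfolding ip_def
    by (rule has_sum_bounded_linear[OF _ T])
      (intro bounded_linear_compose[OF bounded_linear_cinner_left]
        bounded_linear_compose[OF blinfun.bounded_linear_right] blinfun.bounded_linear_left)
  moreover have "((\<lambda>n. ip x (?h n y)) has_sum ip x (?T y)) N"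
    unfolding ip_def
    by (rule has_sum_bounded_linear[OF _ T])
      (intro bounded_linear_compose[OF bounded_linear_cinner_right] blinfun.bounded_linear_left)
  moreover have "ip (?h n x) y = ip x (?h n y)" for n
    using ip_commute[of y "f n"]
    by (simp add: op_scaleC.rep_eq P_apply ip_scaleC_left ip_scaleC_right mult_ac)
  ultimately show ?thesis by (simp add: has_sum_unique)
qed

text \<open>If \<open>A S\<close> had a part not captured by the eigensystem, this part would have an eigenvector
  orthogonal to all \<open>f n\<close>, hence \<open>S A\<close> an eigenvalue of larger multiplicity.\<close>

lemma AS_eq_diagonal:
  assumes mult: "\<And>z::complex. z \<noteq> 0 \<Longrightarrow> finite {n\<in>N. complex_of_real (lam n) = z} \<and>
      card {n\<in>N. complex_of_real (lam n) = z} = complex_vector.dim {x. (S o\<^sub>L A) x = z *\<^sub>C x}"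
  shows "A o\<^sub>L S = diagonal (\<lambda>n. complex_of_real (lam n))"
proof (rule ccontr)
  define T where "T = diagonal (\<lambda>n. complex_of_real (lam n))"
  define D where "D = (A o\<^sub>L S) - T"
  assume "A o\<^sub>L S \<noteq> diagonal (\<lambda>n. complex_of_real (lam n))"
  then have "D \<noteq> 0" by (simp add: D_def T_def)
  have T_ops: "T \<in> bounded_ops"
    unfolding T_def by (rule diagonal_ops[OF dominated_lam])
  have T_f: "T (f n) = complex_of_real (lam n) *\<^sub>C f n" if "n \<in> N" for n
    unfolding T_def by (rule diagonal_f[OF dominated_lam that])
  have AS_ops: "A o\<^sub>L S \<in> bounded_ops"
    by (intro bounded_ops_compose A_ops S_ops)
  have D_ops: "D \<in> bounded_ops"
    using T_ops AS_ops
    by (simp add: D_def bounded_ops_def blinfun.diff_left complex_vector.scale_right_diff_distrib)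
  have D_sym: "ip (D x) y = ip x (D y)" for x y
    by (simp add: D_def T_def blinfun.diff_left ip_diff_left ip_diff_right ip_AS ip_diagonal_lam)
  \<comment> \<open>Both \<open>A o\<^sub>L S\<close> and \<open>T\<close> multiply
    \<open>f n\<close> by \<open>lam n\<close>, so composed with \<open>T\<close> they give the same
    diagonal operator, with coefficients \<open>(lam n)\<^sup>2\<close>.\<close>
  have AST: "A o\<^sub>L S o\<^sub>L T = T o\<^sub>L T"
    unfolding T_def[symmetric]
    using diagonal_compose_left[OF AS_ops _ dominated_lam] diagonal_compose_left[OF T_ops T_f dominated_lam]
    by (simp add: T_def AS_f)
  have DT: "D (T x) = 0" for x
    using arg_cong[OF AST, of "\<lambda>B. blinfun_apply B x"] by (simp add: D_def blinfun.diff_left)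
  \<comment> \<open>Symmetry reverses the order: \<open>ip y (T (D x)) = ip (D (T y)) x = 0\<close>,
    and \<open>ip\<close> is definite.\<close>
  have TD: "T (D x) = 0" for x
  proof (rule cinner_eqI)
    have "ip y (T (D x)) = 0" for y
      using ip_diagonal_lam[of y "D x"] D_sym[of "T y" x] DT[of y] unfolding T_def[symmetric]
      by simp
    from this[of "T (D x)"] show "cinner (T (D x)) y = cinner 0 y" for y
      by (simp add: ip_self)
  qed
  \<comment> \<open>One \<open>opc\<close> comes from A S, the other from \<open>T\<close>, whose
    coefficients are dominated with constant 1.\<close>
  have bound: "(norm (D x))\<^sup>2 \<le> (2 * opc)\<^sup>2 * sq x" for x
  proof -
    have "norm (D x) \<le> norm (A (S x)) + norm (T x)"
      unfolding D_def by (simp add: blinfun.diff_left norm_triangle_ineq4)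
    also have "\<dots> \<le> 2 * opc * sqrt (sq x)"
      using norm_AS_le[of x] norm_diagonal_apply_le[OF dominated_lam, of x]
      unfolding T_def[symmetric] by linarith
    finally have "(norm (D x))\<^sup>2 \<le> (2 * opc * sqrt (sq x))\<^sup>2"
      by (rule power_mono) simp
    then show ?thesis by (simp add: power_mult_distrib)
  qed
  \<comment> \<open>T D = 0 makes the square of \<open>D\<close> factor through \<open>S\<close>,
    with \<open>A\<close> in the role of the \<open>U\<close> of
    \<open>ex_eigenvector\<close>.\<close>
  have D_sq: "D (D x) = A (S (D x))" for x
    using TD[of x] by (simp add: arg_cong[OF D_def, of "\<lambda>B. blinfun_apply B (D x)"]
        blinfun.diff_left)
  obtain \<mu> :: real and y where \<mu>: "\<mu> \<noteq> 0" and y: "y \<noteq> 0" "D y = complex_of_real \<mu> *\<^sub>C y"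
    by (rule ex_eigenvector[OF S_compact D_ops D_sym bound D_sq \<open>D \<noteq> 0\<close>])
  have "T (D y) = complex_of_real \<mu> *\<^sub>C T y"
    unfolding y(2) by (rule bounded_ops_scaleC[OF T_ops])
  then have Ty: "T y = 0" using TD[of y] \<mu> by simp
  then have ASy: "A (S y) = complex_of_real \<mu> *\<^sub>C y"
    using y(2) by (simp add: D_def blinfun.diff_left)
  have ip_y: "ip y (f n) = 0" "ip (f n) y = 0" if n: "n \<in> N" for n
  proof -
    have "ip (T y) (f n) = complex_of_real (lam n) * ip y (f n)"
      unfolding T_def ip_diagonal_lam
      by (simp add: T_def[symmetric] T_f[OF n] ip_scaleC_right)
    then show "ip y (f n) = 0" using Ty lam_nonzero[OF n] by simp
    then show "ip (f n) y = 0" using ip_commute[of "f n" y] by simp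
  qed
  define z where "z = complex_of_real \<mu>"
  have "z \<noteq> 0" using \<mu> by (simp add: z_def)
  define J where "J = {n\<in>N. complex_of_real (lam n) = z}"
  define V where "V = {x. (S o\<^sub>L A) x = z *\<^sub>C x}"
  have J: "finite J" "card J = complex_vector.dim V"
    using mult[OF \<open>z \<noteq> 0\<close>] by (auto simp: J_def V_def)
  have V: "complex_vector.subspace V"
    unfolding V_def complex_vector.subspace_def
    by (auto simp: blinfun.zero_right blinfun.add_right scaleC_add_right scaleC_scaleC
        bounded_ops_scaleC[OF S_ops] bounded_ops_scaleC[OF A_ops] mult.commute)
  \<comment> \<open>\<open>dim\<close> is 0 for an infinite-dimensional space, so
    \<open>card J = dim V\<close> becomes informative only once \<open>V\<close> has a finite
    spanning set. On \<open>V\<close> the operator S A scales norms by \<open>cmod z\<close>, hence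
    is bounded below.\<close>
  obtain B where B: "finite B" "B \<subseteq> V" "V \<subseteq> complex_vector.span B"
  proof (rule finite_span_if_compact_bounded_below[OF S_compact V])
    show "0 < 1 / cmod z" using \<open>z \<noteq> 0\<close> by simp
    show "norm x \<le> 1 / cmod z * norm (S (A x))" if "x \<in> V" for x
      using that \<open>z \<noteq> 0\<close> by (simp add: V_def norm_scaleC)
  qed
  obtain B0 where B0: "B0 \<subseteq> V" "complex_vector.independent B0" "V \<subseteq> complex_vector.span B0"
    "card B0 = complex_vector.dim V"
    by (rule complex_vector.basis_exists)
  have "finite B0"
    using complex_vector.independent_span_bound[OF B(1) B0(2)] B0(1) B(3) by blast
  \<comment> \<open>One vector more than the multiplicity allows: \<open>y\<close> and all
    \<open>f n\<close> for the eigenvalue \<open>z\<close>. \<open>S\<close> maps them injectively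
    into \<open>V\<close>, because S A S e = z S e.\<close>
  define E where "E = insert y (f ` J)"
  have fin_E: "finite E" using J by (simp add: E_def)
  have inj_f: "inj_on f J"
  proof (rule inj_onI)
    fix k l assume "k \<in> J" "l \<in> J" "f k = f l"
    then show "k = l" using ip_f[of k l] ip_f[of l l] by (auto simp: J_def split: if_splits)
  qed
  have "y \<notin> f ` J"
  proof
    assume "y \<in> f ` J"
    then obtain n where "n \<in> N" "y = f n" by (auto simp: J_def)
    with ip_y(1)[of n] ip_f[of n n] show False by simp
  qed
  then have card_E: "card E = Suc (card J)"
    using J by (simp add: E_def card_image[OF inj_f])
  have ortho: "ip e e' = 0" if "e \<in> E" "e' \<in> E" "e \<noteq> e'" for e e'
    using that ip_y ip_f by (fastforce simp: E_def J_def)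
  have nonzero: "sq e \<noteq> 0" if "e \<in> E" for e
  proof -
    have "f n \<noteq> 0" if "n \<in> N" for n using ip_f[OF that that] by auto
    with that y(1) have "e \<noteq> 0" by (auto simp: E_def J_def)
    then show ?thesis by simp
  qed
  have inj_S: "inj_on (blinfun_apply S) E"
  proof (rule inj_onI)
    fix u v assume "S u = S v"
    then have "ip (u - v) (u - v) = 0" by (simp add: ip_def blinfun.diff_right)
    then show "u = v" by (simp add: ip_self)
  qed
  have "complex_vector.independent (blinfun_apply S ` E)"
    unfolding complex_vector.dependent_finite[OF finite_imageI[OF fin_E]]
  proof (rule notI, elim exE conjE)
    fix u assume u: "\<exists>v\<in>blinfun_apply S ` E. u v \<noteq> 0" "(\<Sum>v\<in>blinfun_apply S ` E. u v *\<^sub>C v) = 0"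
    then obtain e where e: "e \<in> E" "u (S e) \<noteq> 0" by blast
    have "(\<Sum>v\<in>E. u (S v) *\<^sub>C S v) = 0"
      using u(2) by (simp add: sum.reindex[OF inj_S] comp_def)
    \<comment> \<open>The Hilbert product of \<open>S v\<close> with \<open>e\<close> is
      \<open>ip v e\<close>, so orthogonality for \<open>ip\<close> isolates the coefficient of
      \<open>S e\<close>.\<close>
    then have "cinner (\<Sum>v\<in>E. u (S v) *\<^sub>C S v) e = 0" by simp
    then have "(\<Sum>v\<in>E. u (S v) * ip v e) = 0"
      by (simp add: cinner_sum_left cinner_scaleC_left ip_def)
    moreover have "(\<Sum>v\<in>E. u (S v) * ip v e) = (\<Sum>v\<in>{e}. u (S v) * ip v e)"
      by (rule sum.mono_neutral_right) (use fin_E e ortho in auto)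
    ultimately show False using e nonzero[of e] by (simp add: ip_self)
  qed
  moreover have "blinfun_apply S ` E \<subseteq> V"
  proof -
    have "A (S e) = z *\<^sub>C e" if "e \<in> E" for e
      using that ASy AS_f by (auto simp: E_def J_def z_def)
    then show ?thesis
      by (auto simp: V_def bounded_ops_scaleC[OF S_ops])
  qed
  ultimately have "card (blinfun_apply S ` E) \<le> card B0"
    using complex_vector.independent_span_bound[OF \<open>finite B0\<close>] B0(3) by blast
  then show False
    using J(2) B0(4) card_E by (simp add: card_image[OF inj_S])
qed

end

section \<open>Continuously differentiable functions\<close>

lemma C1_restrictI:
  assumes "\<And>t. t \<in> {a..b} \<Longrightarrow> (\<phi> has_vector_derivative \<phi>' t) (at t within {a..b})"
    and "continuous_on {a..b} \<phi>'"
  shows "(\<lambda>t\<in>{a..b}. \<phi> t) \<in> C1 a b"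
proof -
  have "((\<lambda>t\<in>{a..b}. \<phi> t) has_vector_derivative \<phi>' t) (at t within {a..b})"
    if "t \<in> {a..b}" for t
    by (rule has_vector_derivative_transform[OF that _ assms(1)[OF that]]) simp
  with assms(2) show ?thesis
    unfolding C1_def by (intro CollectI conjI restrict_extensional exI[of _ \<phi>'] ballI)
qed

lemma C1_diff:
  assumes "\<phi> \<in> C1 a b" "\<psi> \<in> C1 a b"
  shows "(\<lambda>t\<in>{a..b}. \<phi> t - \<psi> t) \<in> C1 a b"
proof -
  obtain \<phi>' \<psi>' where
    "\<forall>t\<in>{a..b}. (\<phi> has_vector_derivative \<phi>' t) (at t within {a..b})" "continuous_on {a..b} \<phi>'"
    "\<forall>t\<in>{a..b}. (\<psi> has_vector_derivative \<psi>' t) (at t within {a..b})" "continuous_on {a..b} \<psi>'"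
    using assms unfolding C1_def by auto
  then show ?thesis
    by (intro C1_restrictI[where \<phi>' = "\<lambda>t. \<phi>' t - \<psi>' t"] has_vector_derivative_diff
        continuous_on_diff) auto
qed

lemma C1_poly: "(\<lambda>t\<in>{a..b}. poly p (complex_of_real t)) \<in> C1 a b"
  by (rule C1_restrictI[where \<phi>' = "\<lambda>t. poly (pderiv p) (complex_of_real t)"])
    (auto intro!: has_vector_derivative_real_field continuous_intros)

text \<open>Mean value inequality with the supremum of the derivative as constant.
  \<open>a < b\<close> makes derivatives within the interval unique, end points included, so the
  \<open>vector_derivative\<close> in \<open>C1_norm\<close> is the derivative that membership in
  \<open>C1\<close> provides.\<close>

lemma
  assumes "a < b" and \<phi>: "\<phi> \<in> C1 a b"
  shows cmod_le_C1_norm: "t \<in> {a..b} \<Longrightarrow> cmod (\<phi> t) \<le> C1_norm a b \<phi>"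
    and C1_norm_Lipschitz: "s \<in> {a..b} \<Longrightarrow> t \<in> {a..b} \<Longrightarrow>
      cmod (\<phi> s - \<phi> t) \<le> C1_norm a b \<phi> * \<bar>s - t\<bar>"
proof -
  obtain \<phi>' where \<phi>': "\<And>t. t \<in> {a..b} \<Longrightarrow> (\<phi> has_vector_derivative \<phi>' t) (at t within {a..b})"
    and cont: "continuous_on {a..b} \<phi>'"
    using \<phi> unfolding C1_def by blast
  have deriv: "vector_derivative \<phi> (at t within {a..b}) = \<phi>' t" if "t \<in> {a..b}" for t
    by (rule vector_derivative_within_closed_interval[OF \<open>a < b\<close> that \<phi>'[OF that]])
  define m0 where "m0 = (SUP t\<in>{a..b}. cmod (\<phi> t))"
  define m1 where "m1 = (SUP t\<in>{a..b}. cmod (\<phi>' t))"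
  have norm: "C1_norm a b \<phi> = m0 + m1"
    unfolding C1_norm_def m0_def m1_def using deriv by simp
  have bdd: "bdd_above ((\<lambda>t. cmod (h t)) ` {a..b})" if "continuous_on {a..b} h"
    for h :: "real \<Rightarrow> complex"
    by (intro bounded_imp_bdd_above compact_imp_bounded compact_continuous_image
        continuous_on_norm that compact_Icc)
  have "continuous_on {a..b} \<phi>"
    unfolding continuous_on_eq_continuous_within
    using \<phi>' has_vector_derivative_continuous by blast
  then have m0: "cmod (\<phi> t) \<le> m0" if "t \<in> {a..b}" for t
    unfolding m0_def by (intro cSUP_upper[OF that] bdd)
  have m1: "cmod (\<phi>' t) \<le> m1" if "t \<in> {a..b}" for t
    unfolding m1_def by (intro cSUP_upper[OF that] bdd cont)
  have "a \<in> {a..b}" using \<open>a < b\<close> by simp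
  from m0[OF this] m1[OF this] have nonneg: "0 \<le> m0" "0 \<le> m1"
    using norm_ge_zero order_trans by blast+
  show "cmod (\<phi> t) \<le> C1_norm a b \<phi>" if "t \<in> {a..b}"
    using m0[OF that] nonneg norm by linarith
  assume s: "s \<in> {a..b}" and t: "t \<in> {a..b}"
  have "cmod (\<phi> s - \<phi> t) \<le> m1 * norm (s - t)"
  proof (rule differentiable_bound[where S = "{a..b}" and f' = "\<lambda>x h. h *\<^sub>R \<phi>' x"])
    show "(\<phi> has_derivative (\<lambda>h. h *\<^sub>R \<phi>' x)) (at x within {a..b})" if "x \<in> {a..b}" for x
      using \<phi>'[OF that] by (simp add: has_vector_derivative_def)
    show "onorm (\<lambda>h. h *\<^sub>R \<phi>' x) \<le> m1" if "x \<in> {a..b}" for x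
      by (rule onorm_bound[OF nonneg(2)])
        (use m1[OF that] in \<open>simp add: mult.commute[of m1] mult_left_mono\<close>)
  qed (use s t in auto)
  also have "\<dots> \<le> C1_norm a b \<phi> * \<bar>s - t\<bar>"
    using nonneg norm by (simp add: mult_right_mono)
  finally show "cmod (\<phi> s - \<phi> t) \<le> C1_norm a b \<phi> * \<bar>s - t\<bar>" .
qed

section \<open>The functional calculus\<close>

lemma op_poly_eq_sum:
  assumes "degree p \<le> d"
  shows "op_poly p T = (\<Sum>i\<le>d. op_scaleC (coeff p i) (op_power T i))"
  unfolding op_poly_def
  by (rule sum.mono_neutral_left) (use assms in \<open>auto simp: coeff_eq_0\<close>)

lemma op_poly_pCons:
  assumes "T \<in> bounded_ops"
  shows "op_poly (pCons c p) T = op_scaleC c id_blinfun + (T o\<^sub>L op_poly p T)"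
proof -
  \<comment> \<open>Summing up to \<open>Suc (degree p)\<close> also covers \<open>p = 0\<close>,
    where \<open>pCons c p\<close> has degree 0 and the extra coefficient vanishes.\<close>
  have "op_poly (pCons c p) T =
      (\<Sum>i\<le>Suc (degree p). op_scaleC (coeff (pCons c p) i) (op_power T i))"
    by (rule op_poly_eq_sum) (simp add: degree_pCons_le)
  also have "\<dots> = op_scaleC c id_blinfun +
      (\<Sum>i\<le>degree p. op_scaleC (coeff p i) (T o\<^sub>L op_power T i))"
    unfolding sum.atMost_Suc_shift by (simp add: op_power_0 op_power_Suc)
  also have "(\<Sum>i\<le>degree p. op_scaleC (coeff p i) (T o\<^sub>L op_power T i)) = T o\<^sub>L op_poly p T"
    unfolding op_poly_def
    by (simp add: bounded_bilinear.sum_right[OF bounded_bilinear_blinfun_compose]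
        op_scaleC_compose_right[OF assms])
  finally show ?thesis .
qed

locale eigensystem_in_interval = eigensystem S A N lam f
  for S A :: "'a::complex_hilbert \<Rightarrow>\<^sub>L 'a" and N lam f +
  fixes a b :: real
  assumes a_less_b: "a < b" and zero_in: "0 \<in> {a..b}" and lam_in: "\<And>n. n \<in> N \<Longrightarrow> lam n \<in> {a..b}"
    and AS_diagonal: "A o\<^sub>L S = diagonal (\<lambda>n. complex_of_real (lam n))"
begin

text \<open>The map Phi of the theorem; \<open>zero_in\<close> ensures that \<open>\<phi> 0\<close>
  is a genuine value and not \<open>undefined\<close>.\<close>

definition calc :: "(real \<Rightarrow> complex) \<Rightarrow> 'a \<Rightarrow>\<^sub>L 'a" where
  "calc \<phi> = op_scaleC (\<phi> 0) id_blinfun + diagonal (\<lambda>n. \<phi> (lam n) - \<phi> 0)"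

lemma dominated_C1:
  assumes "\<phi> \<in> C1 a b"
  shows "dominated (C1_norm a b \<phi>) (\<lambda>n. \<phi> (lam n) - \<phi> 0)"
  unfolding dominated_def
proof (intro conjI ballI)
  show "0 \<le> C1_norm a b \<phi>"
    using cmod_le_C1_norm[OF a_less_b assms zero_in] norm_ge_zero order_trans by blast
  show "cmod (\<phi> (lam n) - \<phi> 0) \<le> C1_norm a b \<phi> * \<bar>lam n\<bar>" if "n \<in> N" for n
    using C1_norm_Lipschitz[OF a_less_b assms lam_in[OF that] zero_in] by simp
qed

lemmas C1_has_sum = diagonal_has_sum[OF dominated_C1]

lemma calc_ops: "\<phi> \<in> C1 a b \<Longrightarrow> calc \<phi> \<in> bounded_ops"
  unfolding calc_def
  by (intro bounded_ops_add bounded_ops_op_scaleC bounded_ops_id diagonal_ops[OF dominated_C1])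

lemma calc_eqI:
  assumes "((\<lambda>n. op_scaleC (\<phi> (lam n) - \<phi> 0) (P n)) has_sum T) N"
  shows "calc \<phi> = op_scaleC (\<phi> 0) id_blinfun + T"
  unfolding calc_def diagonal_eqI[OF assms] ..

lemma calc_f:
  assumes "\<phi> \<in> C1 a b" "n \<in> N"
  shows "calc \<phi> (f n) = \<phi> (lam n) *\<^sub>C f n"
  using diagonal_f[OF dominated_C1 assms(2), OF assms(1)]
  by (simp add: calc_def blinfun.add_left op_scaleC.rep_eq flip: scaleC_add_left)

lemma calc_add:
  assumes "\<phi> \<in> C1 a b" "\<psi> \<in> C1 a b"
  shows "calc (\<lambda>t\<in>{a..b}. \<phi> t + \<psi> t) = calc \<phi> + calc \<psi>"
proof -
  let ?\<chi> = "\<lambda>t\<in>{a..b}. \<phi> t + \<psi> t"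
  have "((\<lambda>n. op_scaleC (\<phi> (lam n) - \<phi> 0) (P n) + op_scaleC (\<psi> (lam n) - \<psi> 0) (P n)) has_sum
      diagonal (\<lambda>n. \<phi> (lam n) - \<phi> 0) + diagonal (\<lambda>n. \<psi> (lam n) - \<psi> 0)) N"
    by (intro has_sum_add C1_has_sum assms)
  also have "?this \<longleftrightarrow> ((\<lambda>n. op_scaleC (?\<chi> (lam n) - ?\<chi> 0) (P n)) has_sum
      diagonal (\<lambda>n. \<phi> (lam n) - \<phi> 0) + diagonal (\<lambda>n. \<psi> (lam n) - \<psi> 0)) N"
    by (rule has_sum_cong)
      (use zero_in lam_in in \<open>simp add: algebra_simps flip: op_scaleC_add_left\<close>)
  finally show ?thesis
    using zero_in by (subst calc_eqI) (auto simp: calc_def op_scaleC_add_left)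
qed

lemma calc_scaleC:
  assumes "\<phi> \<in> C1 a b"
  shows "calc (\<lambda>t\<in>{a..b}. c * \<phi> t) = op_scaleC c (calc \<phi>)"
proof -
  let ?\<chi> = "\<lambda>t\<in>{a..b}. c * \<phi> t"
  have "((\<lambda>n. op_scaleC c (op_scaleC (\<phi> (lam n) - \<phi> 0) (P n))) has_sum
      op_scaleC c (diagonal (\<lambda>n. \<phi> (lam n) - \<phi> 0))) N"
    by (rule has_sum_bounded_linear[OF bounded_linear_op_scaleC C1_has_sum[OF assms]])
  also have "?this \<longleftrightarrow> ((\<lambda>n. op_scaleC (?\<chi> (lam n) - ?\<chi> 0) (P n)) has_sum
      op_scaleC c (diagonal (\<lambda>n. \<phi> (lam n) - \<phi> 0))) N"
    by (rule has_sum_cong)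
      (use zero_in lam_in in \<open>simp add: op_scaleC_scaleC right_diff_distrib\<close>)
  finally show ?thesis
    using zero_in
    by (subst calc_eqI) (auto simp: calc_def op_scaleC_add_right op_scaleC_scaleC)
qed

lemma calc_diff:
  assumes "\<phi> \<in> C1 a b" "\<psi> \<in> C1 a b"
  shows "calc (\<lambda>t\<in>{a..b}. \<phi> t - \<psi> t) = calc \<phi> - calc \<psi>"
proof -
  let ?\<chi> = "\<lambda>t\<in>{a..b}. \<phi> t - \<psi> t"
  \<comment> \<open>Members of \<open>C1\<close> are extensional, so adding \<open>\<psi>\<close>
    back returns \<open>\<phi>\<close> itself and \<open>calc_add\<close> applies.\<close>
  have "(\<lambda>t\<in>{a..b}. ?\<chi> t + \<psi> t) = \<phi>"
    using assms(1) by (auto simp: C1_def fun_eq_iff extensional_def)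
  then show ?thesis
    using calc_add[OF C1_diff[OF assms] assms(2)] by (simp add: algebra_simps)
qed

text \<open>The coefficients split as \<open>\<phi>(l) \<psi>(l) - \<phi>(0) \<psi>(0) = \<phi>(l)
  (\<psi>(l) - \<psi>(0)) + \<psi>(0) (\<phi>(l) - \<phi>(0))\<close>, and
  \<open>calc \<phi>\<close> multiplies \<open>f n\<close> by \<open>\<phi> (lam n)\<close>.
  Composing \<open>calc \<phi>\<close> with the series for \<open>\<psi>\<close> therefore produces
  no double series.\<close>

lemma calc_mult:
  assumes \<phi>: "\<phi> \<in> C1 a b" and \<psi>: "\<psi> \<in> C1 a b"
  shows "calc (\<lambda>t\<in>{a..b}. \<phi> t * \<psi> t) = calc \<phi> o\<^sub>L calc \<psi>"
proof -
  let ?\<chi> = "\<lambda>t\<in>{a..b}. \<phi> t * \<psi> t"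
  let ?\<alpha> = "\<lambda>n. \<phi> (lam n) - \<phi> 0" and ?\<beta> = "\<lambda>n. \<psi> (lam n) - \<psi> 0"
  have "((\<lambda>n. calc \<phi> o\<^sub>L op_scaleC (?\<beta> n) (P n)) has_sum calc \<phi> o\<^sub>L diagonal ?\<beta>) N"
    by (rule has_sum_bounded_linear[OF bounded_bilinear.bounded_linear_right
          [OF bounded_bilinear_blinfun_compose] C1_has_sum[OF \<psi>]])
  moreover have "((\<lambda>n. op_scaleC (\<psi> 0) (op_scaleC (?\<alpha> n) (P n))) has_sum
      op_scaleC (\<psi> 0) (diagonal ?\<alpha>)) N"
    by (rule has_sum_bounded_linear[OF bounded_linear_op_scaleC C1_has_sum[OF \<phi>]])
  ultimately have "((\<lambda>n. (calc \<phi> o\<^sub>L op_scaleC (?\<beta> n) (P n)) +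
        op_scaleC (\<psi> 0) (op_scaleC (?\<alpha> n) (P n))) has_sum
      (calc \<phi> o\<^sub>L diagonal ?\<beta>) + op_scaleC (\<psi> 0) (diagonal ?\<alpha>)) N"
    by (rule has_sum_add)
  also have "?this \<longleftrightarrow> ((\<lambda>n. op_scaleC (?\<chi> (lam n) - ?\<chi> 0) (P n)) has_sum
      (calc \<phi> o\<^sub>L diagonal ?\<beta>) + op_scaleC (\<psi> 0) (diagonal ?\<alpha>)) N"
  proof (rule has_sum_cong)
    fix n assume n: "n \<in> N"
    have "calc \<phi> o\<^sub>L op_scaleC (?\<beta> n) (P n) = op_scaleC (?\<beta> n * \<phi> (lam n)) (P n)"
      by (simp add: op_scaleC_compose_right calc_ops[OF \<phi>] op_scaleC_scaleC
          compose_P_eq[OF calc_ops[OF \<phi>] calc_f[OF \<phi> n]])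
    then show "(calc \<phi> o\<^sub>L op_scaleC (?\<beta> n) (P n)) + op_scaleC (\<psi> 0) (op_scaleC (?\<alpha> n) (P n)) =
        op_scaleC (?\<chi> (lam n) - ?\<chi> 0) (P n)"
      using zero_in lam_in[OF n]
      by (simp add: op_scaleC_scaleC algebra_simps flip: op_scaleC_add_left)
  qed
  finally have "calc ?\<chi> = op_scaleC (?\<chi> 0) id_blinfun +
      ((calc \<phi> o\<^sub>L diagonal ?\<beta>) + op_scaleC (\<psi> 0) (diagonal ?\<alpha>))"
    by (rule calc_eqI)
  also have "\<dots> = op_scaleC (\<psi> 0) (calc \<phi>) + (calc \<phi> o\<^sub>L diagonal ?\<beta>)"
    using zero_in
    by (simp add: calc_def[of \<phi>] op_scaleC_add_right op_scaleC_scaleC mult.commute add_ac)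
  also have "\<dots> = calc \<phi> o\<^sub>L calc \<psi>"
    unfolding calc_def[of \<psi>]
    by (rule blinfun_eqI)
      (simp add: blinfun.add_left blinfun.add_right op_scaleC.rep_eq
        bounded_ops_scaleC[OF calc_ops[OF \<phi>]])
  finally show ?thesis .
qed

lemma calc_one: "calc (\<lambda>t\<in>{a..b}. 1) = id_blinfun"
proof -
  have "((\<lambda>n. op_scaleC ((\<lambda>t\<in>{a..b}. 1) (lam n) - (\<lambda>t\<in>{a..b}. 1) 0) (P n)) has_sum 0) N"
    by (rule has_sum_0) (use zero_in lam_in in auto)
  then show ?thesis using zero_in by (subst calc_eqI) auto
qed

text \<open>The place where completeness of the eigenvectors, in the form
  \<open>AS_diagonal\<close>, enters the calculus.\<close>

lemma calc_id: "calc (\<lambda>t\<in>{a..b}. complex_of_real t) = A o\<^sub>L S"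
proof -
  have "((\<lambda>n. op_scaleC (complex_of_real (lam n)) (P n)) has_sum (A o\<^sub>L S)) N"
    unfolding AS_diagonal by (rule diagonal_has_sum[OF dominated_lam])
  also have "?this \<longleftrightarrow> ((\<lambda>n. op_scaleC ((\<lambda>t\<in>{a..b}. complex_of_real t) (lam n) -
      (\<lambda>t\<in>{a..b}. complex_of_real t) 0) (P n)) has_sum (A o\<^sub>L S)) N"
    by (rule has_sum_cong) (use zero_in lam_in in auto)
  finally show ?thesis
    using zero_in by (subst calc_eqI) auto
qed

lemma calc_poly: "calc (\<lambda>t\<in>{a..b}. poly p (complex_of_real t)) = op_poly p (A o\<^sub>L S)"
proof (induction p)
  case 0
  have "calc (\<lambda>t\<in>{a..b}. 0 * poly 1 (complex_of_real t)) = 0"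
    using calc_scaleC[OF C1_poly[where p = 1], of 0] by simp
  then show ?case by (simp add: op_poly_def restrict_def)
next
  case (pCons c p)
  let ?p = "\<lambda>t\<in>{a..b}. poly p (complex_of_real t)"
  let ?t = "\<lambda>t\<in>{a..b}. complex_of_real t"
  let ?c = "\<lambda>t\<in>{a..b}. c"
  let ?tp = "\<lambda>t\<in>{a..b}. ?t t * ?p t"
  have C1: "?p \<in> C1 a b" "?t \<in> C1 a b" "(\<lambda>t\<in>{a..b}. 1) \<in> C1 a b" "?c \<in> C1 a b" "?tp \<in> C1 a b"
    using C1_poly[where p = p] C1_poly[where p = "[:0, 1:]"] C1_poly[where p = 1] C1_poly[where p = "[:c:]"]
      C1_poly[where p = "pCons 0 p"]
    by (simp_all add: restrict_def cong: if_cong)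
  have p: "(\<lambda>t\<in>{a..b}. poly (pCons c p) (complex_of_real t)) = (\<lambda>t\<in>{a..b}. ?c t + ?tp t)"
    by auto
  have "?c = (\<lambda>t\<in>{a..b}. c * (\<lambda>t\<in>{a..b}. 1) t)"
    by auto
  then have c: "calc ?c = op_scaleC c id_blinfun"
    using calc_scaleC[OF C1(3), of c] by (simp add: calc_one)
  have tp: "calc ?tp = A o\<^sub>L S o\<^sub>L op_poly p (A o\<^sub>L S)"
    unfolding calc_mult[OF C1(2) C1(1)] calc_id pCons.IH ..
  show ?case
    unfolding p calc_add[OF C1(4,5)] c tp
      op_poly_pCons[OF bounded_ops_compose[OF A_ops S_ops]] ..
qed

text \<open>The 1 accounts for \<open>\<phi> 0\<close> times the identity;
  \<open>opc * sqrt (norm S)\<close> equals \<open>norm A * norm S\<close> and accounts for the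
  series.\<close>

lemma norm_calc_le:
  assumes "\<phi> \<in> C1 a b"
  shows "norm (calc \<phi>) \<le> (1 + opc * sqrt (norm S)) * C1_norm a b \<phi>"
proof -
  have "norm (op_scaleC (\<phi> 0) (id_blinfun :: 'a \<Rightarrow>\<^sub>L 'a)) \<le> cmod (\<phi> 0) * norm (id_blinfun :: 'a \<Rightarrow>\<^sub>L 'a)"
    by (rule norm_op_scaleC_le)
  also have "\<dots> \<le> cmod (\<phi> 0) * 1"
    by (intro mult_left_mono norm_blinfun_bound) auto
  also have "\<dots> \<le> C1_norm a b \<phi>"
    using cmod_le_C1_norm[OF a_less_b assms zero_in] by simp
  finally have "norm (calc \<phi>) \<le> C1_norm a b \<phi> + opc * sqrt (norm S) * C1_norm a b \<phi>"
    unfolding calc_def using norm_diagonal_le[OF dominated_C1[OF assms]]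
    by (intro norm_triangle_le) linarith
  then show ?thesis by (simp add: algebra_simps)
qed

lemma calc_continuous: "C1_norm_continuous a b calc"
  unfolding C1_norm_continuous_def
proof (intro ballI allI impI)
  fix \<phi> \<epsilon> assume \<phi>: "\<phi> \<in> C1 a b" and "0 < (\<epsilon>::real)"
  define C where "C = 1 + opc * sqrt (norm S)"
  have "0 < C" unfolding C_def by (intro add_pos_nonneg) auto
  show "\<exists>\<delta>>0. \<forall>\<psi>\<in>C1 a b. C1_norm a b (\<lambda>t\<in>{a..b}. \<psi> t - \<phi> t) < \<delta> \<longrightarrow> norm (calc \<psi> - calc \<phi>) < \<epsilon>"
  proof (intro exI[of _ "\<epsilon> / C"] conjI ballI impI)
    show "0 < \<epsilon> / C" using \<open>0 < \<epsilon>\<close> \<open>0 < C\<close> by simp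
    fix \<psi> assume \<psi>: "\<psi> \<in> C1 a b" and less: "C1_norm a b (\<lambda>t\<in>{a..b}. \<psi> t - \<phi> t) < \<epsilon> / C"
    have "norm (calc \<psi> - calc \<phi>) \<le> C * C1_norm a b (\<lambda>t\<in>{a..b}. \<psi> t - \<phi> t)"
      using norm_calc_le[OF C1_diff[OF \<psi> \<phi>]] unfolding calc_diff[OF \<psi> \<phi>] C_def .
    also have "\<dots> < \<epsilon>" using less \<open>0 < C\<close> by (simp add: field_simps)
    finally show "norm (calc \<psi> - calc \<phi>) < \<epsilon>" .
  qed
qed

lemma calc_hom: "C1_unital_algebra_hom a b calc"
  unfolding C1_unital_algebra_hom_def
  by (simp add: calc_ops calc_add calc_scaleC calc_mult calc_one)

end

section \<open>Points of the spectrum and the final assembly\<close>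

lemma eigenvalue_in_op_spectrum:
  fixes T :: "'a::complex_hilbert \<Rightarrow>\<^sub>L 'a"
  assumes "T x = z *\<^sub>C x" "x \<noteq> 0"
  shows "z \<in> op_spectrum T"
proof (rule ccontr)
  assume "z \<notin> op_spectrum T"
  then obtain R where "R o\<^sub>L (T - op_scaleC z id_blinfun) = id_blinfun"
    by (auto simp: op_spectrum_def)
  from arg_cong[OF this, of "\<lambda>B. blinfun_apply B x"] have "R (T x - z *\<^sub>C x) = x"
    by (simp add: blinfun.diff_left op_scaleC.rep_eq)
  with assms show False by (simp add: blinfun.zero_right)
qed

text \<open>A left inverse would bound S A from below on the whole space, which by compactness of
  \<open>S\<close> would then be spanned by a finite set. Infinite dimension enters here.\<close>

lemma zero_in_op_spectrum_compact:
  fixes S A :: "'a::complex_hilbert \<Rightarrow>\<^sub>L 'a"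
  assumes "compact_op S" and "\<nexists>B :: 'a set. finite B \<and> complex_vector.span B = UNIV"
  shows "0 \<in> op_spectrum (S o\<^sub>L A)"
proof (rule ccontr)
  assume "0 \<notin> op_spectrum (S o\<^sub>L A)"
  then obtain R where R: "R o\<^sub>L (S o\<^sub>L A) = id_blinfun"
    by (auto simp: op_spectrum_def)
  have le: "norm x \<le> (norm R + 1) * norm (S (A x))" for x
  proof -
    have "x = R (S (A x))" using arg_cong[OF R, of "\<lambda>B. blinfun_apply B x"] by simp
    then have "norm x \<le> norm R * norm (S (A x))" by (metis norm_blinfun)
    also have "\<dots> \<le> (norm R + 1) * norm (S (A x))" by (intro mult_right_mono) auto
    finally show ?thesis .
  qed
  have "0 < norm R + 1" by (simp add: add_nonneg_pos)
  then obtain B :: "'a set" where "finite B" "UNIV \<subseteq> complex_vector.span B"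
    by (rule finite_span_if_compact_bounded_below[OF assms(1) complex_vector.subspace_UNIV])
      (use le in auto)
  with assms(2) show False by blast
qed

theorem theorem3p8:
  fixes S A K :: "'a::complex_hilbert \<Rightarrow>\<^sub>L 'a"
    and a b :: real
    and N :: "nat set" and lam :: "nat \<Rightarrow> real" and f g :: "nat \<Rightarrow> 'a"
  assumes "separable_space (euclidean :: 'a topology)"
    and "\<nexists>B :: 'a set. finite B \<and> complex_vector.span B = UNIV"
    and "S \<in> bounded_ops" and "compact_op S" and "positive_op S"
    and "A \<in> bounded_ops" and "selfadjoint_op A"
    and "K = S o\<^sub>L A"
    and "a < b" and "op_spectrum K \<subseteq> complex_of_real ` {a..b}"
    and "eigen_list S K N lam f g"
  shows "\<exists>\<Phi> :: (real \<Rightarrow> complex) \<Rightarrow> ('a \<Rightarrow>\<^sub>L 'a).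
           C1_unital_algebra_hom a b \<Phi> \<and>
           C1_norm_continuous a b \<Phi> \<and>
           (\<forall>\<phi>\<in>C1 a b.
              ((\<lambda>n. op_scaleC (\<phi> (lam n) - \<phi> 0) (rank_one (f n) (g n)))
                 has_sum (\<Phi> \<phi> - op_scaleC (\<phi> 0) id_blinfun)) N) \<and>
           (\<forall>p :: complex poly.
              \<Phi> (\<lambda>t\<in>{a..b}. poly p (complex_of_real t)) = op_poly p (adjoint_op K))"
proof -
  interpret symmetrizable S A
    by unfold_locales (use assms in \<open>auto simp: selfadjoint_op_def is_adjoint_def\<close>)
  have adj: "adjoint_op K = A o\<^sub>L S"
    unfolding \<open>K = S o\<^sub>L A\<close> by (rule adjoint_op_eq[OF is_adjoint_SA])
  note el = \<open>eigen_list S K N lam f g\<close>[unfolded eigen_list_def adj]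
  have g: "g n = S (f n)" if "n \<in> N" for n
    using el that by blast
  have f_g: "cinner (f k) (g l) = (if k = l then 1 else 0)" if "k \<in> N" "l \<in> N" for k l
    using el that by blast
  interpret eigensystem S A N lam f
  proof
    show "orthonormal N f"
      unfolding orthonormal_def ip_def S_selfadjoint using f_g g by simp
    show "lam n \<noteq> 0" if "n \<in> N" for n using el that by blast
    show "A (S (f n)) = complex_of_real (lam n) *\<^sub>C f n" if "n \<in> N" for n
      using el that by simp
  qed
  have AS: "A o\<^sub>L S = diagonal (\<lambda>n. complex_of_real (lam n))"
    by (rule AS_eq_diagonal) (use el \<open>K = S o\<^sub>L A\<close> in blast)
  have interval: "t \<in> {a..b}" if "complex_of_real t \<in> op_spectrum K" for t
    using that assms(10) by auto
  interpret eigensystem_in_interval S A N lam f a b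
  proof
    show "0 \<in> {a..b}"
      using zero_in_op_spectrum_compact[OF assms(4,2), of A] interval[of 0] \<open>K = S o\<^sub>L A\<close> by simp
    \<comment> \<open>The interval is tied to the spectrum of \<open>K\<close>, so the eigenvectors
      \<open>g n\<close> of \<open>K\<close> are used; the normalization keeps them nonzero.\<close>
    show "lam n \<in> {a..b}" if n: "n \<in> N" for n
    proof (rule interval, rule eigenvalue_in_op_spectrum)
      show "K (g n) = complex_of_real (lam n) *\<^sub>C g n" using el n by blast
      show "g n \<noteq> 0" using f_g[OF n n] by auto
    qed
  qed (rule \<open>a < b\<close>, rule AS)
  show ?thesis
  proof (intro exI[of _ calc] conjI ballI allI)
    show "C1_unital_algebra_hom a b calc" by (rule calc_hom)
    show "C1_norm_continuous a b calc" by (rule calc_continuous)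
    show "calc (\<lambda>t\<in>{a..b}. poly p (complex_of_real t)) = op_poly p (adjoint_op K)" for p
      unfolding adj by (rule calc_poly)
    fix \<phi> assume \<phi>: "\<phi> \<in> C1 a b"
    have "((\<lambda>n. op_scaleC (\<phi> (lam n) - \<phi> 0) (P n)) has_sum
        (calc \<phi> - op_scaleC (\<phi> 0) id_blinfun)) N"
      using C1_has_sum[OF \<phi>] by (simp add: calc_def)
    then show "((\<lambda>n. op_scaleC (\<phi> (lam n) - \<phi> 0) (rank_one (f n) (g n))) has_sum
        (calc \<phi> - op_scaleC (\<phi> 0) id_blinfun)) N"
      by (rule has_sum_cong[THEN iffD1, rotated]) (simp add: g)
  qed
qed

end
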